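(* Let $(T(t))_{t\ge 0}$ be a contraction semigroup on $(X,\|\cdot\|)$, bi-continuous with respect to $\tau$, and let $(A,D(A))$ be its $\tau$-generator. Then the following statements are equivalent: (i) $(T(t))_{t\ge 0}$ is $\tau$-mean ergodic, i.e. $C(r)x$ $\tau$-converges in $X$ as $r\to\infty$, for every $x\in X$; (ii) $\lambda R(\lambda,A)x$ $\tau$-converges in $X$ as $\lambda\to0^+$, for every $x\in X$. Moreover, if one of these limits exists, then $\tau\text{-}\lim_{r\to\infty}C(r)x=\tau\text{-}\lim_{\lambda\to0^+}\lambda R(\lambda,A)x$; consequently, $Px=\tau\text{-}\lim_{\lambda\to0^+}\lambda R(\lambda,A)x$, where $Px:=\tau\text{-}\lim_{r\to\infty}C(r)x$.
   Context: Setting: $(X,\|\cdot\|)$ is a Banach space and $\tau$ is a locally convex topology on $X$ such that: (i) every $\|\cdot\|$-bounded $\tau$-Cauchy sequence converges in $(X,\tau)$; (ii) $\tau$ is coarser than the $\|\cdot\|$-topology; (iii) the topological dual $X'_\tau$ of $(X,\tau)$ is norming for $X$, i.e. $\|x\|=\sup\{|\langle x,\phi\rangle| : \phi\in X'_\tau,\ \|\phi\|_{X'}\le 1\}$ for all $x\in X$. A family $(T(t))_{t\ge0}$ of bounded linear operators on $(X,\|\cdot\|)$ is a bi-continuous semigroup with respect to $\tau$ if: $T(0)=I$ and $T(t+s)=T(t)T(s)$ for all $t,s\ge0$; there are $M\ge1$, $\omega\in\mathbb{R}$ with $\|T(t)x\|\le Me^{\omega t}\|x\|$ for all $t\ge 0$,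 $x\in X$; for each $x\in X$ the map $[0,\infty[\,\ni t\mapsto T(t)x\in X$ is $\tau$-continuous; and for every $\|\cdot\|$-bounded sequence $(x_n)$ which $\tau$-converges to $x$, $\tau\text{-}\lim_{n\to\infty}T(t)x_n=T(t)x$ uniformly for $t$ in bounded intervals of $[0,\infty[$. It is a contraction semigroup if $\|T(t)\|\le1$ for all $t\ge0$. The $\tau$-generator $(A,D(A))$ is defined by: $D(A)$ is the set of $x\in X$ such that $\sup_{0<t<1}\left\|\frac{T(t)x-x}{t}\right\|<\infty$ and $\tau\text{-}\lim_{t\to0^+}\frac{T(t)x-x}{t}$ exists in $X$; $Ax$ is this limit. Equivalently, $A$ is the unique closed operator whose resolvent is the $\tau$-Laplace transform of the semigroup: for a contraction semigroup and $\lambda>0$, $R(\lambda,A)x=(\lambda-A)^{-1}x=\int_0^\infty e^{-\lambda t}T(t)x\,dt=\|\cdot\|\text{-}\lim_{a\to\infty}\int_0^ae^{-\lambda t}T(t)x\,dt$, the integrals over $[0,a]$ being $\tau$-Riemann integrals. The Cesàro means are $C(r)x=\frac1r\int_0^rT(s)x\,ds$, $r>0$, $x\in X$ ($\tau$-Riemann integral). *)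

theory Defs
  imports "HOL-Analysis.Analysis"
begin

text \<open>
  The second topology is an abstract topology on the Banach space, separate from the norm topology
  of its type class. Scalars are real; a complex space is covered by restricting scalars: a norming
  complex dual yields a norming real dual by taking real parts, and nothing else below refers to
  the scalar field.
\<close>

definition locally_convex_topology :: "'a::real_vector topology \<Rightarrow> bool" where
  "locally_convex_topology \<tau> \<longleftrightarrow>
     topspace \<tau> = UNIV \<and>
     continuous_map (prod_topology \<tau> \<tau>) \<tau> (\<lambda>(x, y). x + y) \<and>
     continuous_map (prod_topology euclideanreal \<tau>) \<tau> (\<lambda>(c, x). c *\<^sub>R x) \<and>
     (\<forall>U. openin \<tau> U \<and> 0 \<in> U \<longrightarrow> (\<exists>V. openin \<tau> V \<and> convex V \<and> 0 \<in> V \<and> V \<subseteq> U))"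

definition Cauchy_in :: "'a::real_vector topology \<Rightarrow> (nat \<Rightarrow> 'a) \<Rightarrow> bool" where
  "Cauchy_in \<tau> x \<longleftrightarrow>
     (\<forall>U. openin \<tau> U \<and> 0 \<in> U \<longrightarrow> (\<exists>N. \<forall>m\<ge>N. \<forall>n\<ge>N. x m - x n \<in> U))"

definition topological_dual :: "'a::real_vector topology \<Rightarrow> ('a \<Rightarrow> real) set" where
  "topological_dual \<tau> = {\<phi>. linear \<phi> \<and> continuous_map \<tau> euclideanreal \<phi>}"

text \<open>
  The Hausdorff property is not listed separately, since the norming condition implies it. Hence
  all limits and integrals below are unique. Coarseness makes every element of the dual
  norm-bounded, so that its dual norm is the library's operator norm.
\<close>

definition bicontinuous_setting :: "'a::banach topology \<Rightarrow> bool" where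
  "bicontinuous_setting \<tau> \<longleftrightarrow>
     locally_convex_topology \<tau> \<and>
     (\<forall>x. bounded (range x) \<and> Cauchy_in \<tau> x \<longrightarrow> (\<exists>y. limitin \<tau> x y sequentially)) \<and>
     (\<forall>U. openin \<tau> U \<longrightarrow> open U) \<and>
     (\<forall>x. norm x = (SUP \<phi>\<in>{\<phi> \<in> topological_dual \<tau>. onorm \<phi> \<le> 1}. \<bar>\<phi> x\<bar>))"

text \<open>Only the values of a semigroup at nonnegative times are relevant.\<close>

definition bicontinuous_semigroup ::
    "'a::banach topology \<Rightarrow> (real \<Rightarrow> 'a \<Rightarrow>\<^sub>L 'a) \<Rightarrow> bool" where
  "bicontinuous_semigroup \<tau> T \<longleftrightarrow>
     T 0 = id_blinfun \<and>
     (\<forall>t\<ge>0. \<forall>s\<ge>0. T (t + s) = T t o\<^sub>L T s) \<and>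
     (\<exists>M\<ge>1. \<exists>\<omega>. \<forall>t\<ge>0. \<forall>x. norm (T t x) \<le> M * exp (\<omega> * t) * norm x) \<and>
     (\<forall>x. continuous_map (top_of_set {0..}) \<tau> (\<lambda>t. T t x)) \<and>
     (\<forall>x y. bounded (range x) \<and> limitin \<tau> x y sequentially \<longrightarrow>
        (\<forall>b\<ge>0. \<forall>U. openin \<tau> U \<and> 0 \<in> U \<longrightarrow>
           (\<exists>N. \<forall>n\<ge>N. \<forall>t\<in>{0..b}. T t (x n) - T t y \<in> U)))"

definition contraction_semigroup :: "(real \<Rightarrow> 'a::real_normed_vector \<Rightarrow>\<^sub>L 'a) \<Rightarrow> bool" where
  "contraction_semigroup T \<longleftrightarrow> (\<forall>t\<ge>0. norm (T t) \<le> 1)"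

definition Lim_in :: "'a topology \<Rightarrow> 'b filter \<Rightarrow> ('b \<Rightarrow> 'a) \<Rightarrow> 'a" where
  "Lim_in \<tau> F f = (THE y. limitin \<tau> f y F)"

definition generator_domain ::
    "'a::real_normed_vector topology \<Rightarrow> (real \<Rightarrow> 'a \<Rightarrow>\<^sub>L 'a) \<Rightarrow> 'a set" where
  "generator_domain \<tau> T =
     {x. bdd_above ((\<lambda>t. norm ((T t x - x) /\<^sub>R t)) ` {0<..<1}) \<and>
         (\<exists>y. limitin \<tau> (\<lambda>t. (T t x - x) /\<^sub>R t) y (at_right 0))}"

definition generator ::
    "'a::real_normed_vector topology \<Rightarrow> (real \<Rightarrow> 'a \<Rightarrow>\<^sub>L 'a) \<Rightarrow> 'a \<Rightarrow> 'a" where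
  "generator \<tau> T x = Lim_in \<tau> (at_right 0) (\<lambda>t. (T t x - x) /\<^sub>R t)"

text \<open>
  The resolvent of a partially defined operator \<open>A\<close> with domain \<open>D\<close>, meaningful
  when \<open>\<mu> - A\<close> is a bijection from \<open>D\<close> onto the whole space; for the generator of a contraction
  semigroup this is the case for every \<open>\<mu> > 0\<close>.
\<close>

definition resolvent :: "'a::real_vector set \<Rightarrow> ('a \<Rightarrow> 'a) \<Rightarrow> real \<Rightarrow> 'a \<Rightarrow> 'a" where
  "resolvent D A \<mu> = the_inv_into D (\<lambda>y. \<mu> *\<^sub>R y - A y)"

text \<open>
  A constant gauge expresses that the mesh of the tagged partition tends to zero, so this is the
  Riemann and not the Henstock--Kurzweil integral.
\<close>

definition has_Riemann_integral_in ::
    "'a::real_vector topology \<Rightarrow> (real \<Rightarrow> 'a) \<Rightarrow> 'a \<Rightarrow> real \<Rightarrow> real \<Rightarrow> bool" where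
  "has_Riemann_integral_in \<tau> f y a b \<longleftrightarrow>
     (\<forall>U. openin \<tau> U \<and> y \<in> U \<longrightarrow>
        (\<exists>\<delta>>0. \<forall>p. p tagged_division_of {a..b} \<and> (\<lambda>s. ball s \<delta>) fine p \<longrightarrow>
           (\<Sum>(s, K)\<in>p. measure lborel K *\<^sub>R f s) \<in> U))"

definition Riemann_integral_in ::
    "'a::real_vector topology \<Rightarrow> real \<Rightarrow> real \<Rightarrow> (real \<Rightarrow> 'a) \<Rightarrow> 'a" where
  "Riemann_integral_in \<tau> a b f = (THE y. has_Riemann_integral_in \<tau> f y a b)"

definition Cesaro_mean ::
    "'a::real_normed_vector topology \<Rightarrow> (real \<Rightarrow> 'a \<Rightarrow>\<^sub>L 'a) \<Rightarrow> real \<Rightarrow> 'a \<Rightarrow> 'a" where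
  "Cesaro_mean \<tau> T r x = (1 / r) *\<^sub>R Riemann_integral_in \<tau> 0 r (\<lambda>s. T s x)"

definition mean_ergodic ::
    "'a::real_normed_vector topology \<Rightarrow> (real \<Rightarrow> 'a \<Rightarrow>\<^sub>L 'a) \<Rightarrow> bool" where
  "mean_ergodic \<tau> T \<longleftrightarrow> (\<forall>x. \<exists>y. limitin \<tau> (\<lambda>r. Cesaro_mean \<tau> T r x) y at_top)"

definition mean_ergodic_projection ::
    "'a::real_normed_vector topology \<Rightarrow> (real \<Rightarrow> 'a \<Rightarrow>\<^sub>L 'a) \<Rightarrow> 'a \<Rightarrow> 'a" where
  "mean_ergodic_projection \<tau> T x = Lim_in \<tau> at_top (\<lambda>r. Cesaro_mean \<tau> T r x)"

end

theory Submission
  imports Defs "HOL-Real_Asymp.Real_Asymp"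
begin

text \<open>
  For fixed \<open>x\<close>, consider the kernels \<open>k \<in> L\<^sup>1(0,\<infinity>)\<close> for which \<open>\<integral> l k(l t) T(t) x dt\<close> tends to
  \<open>(\<integral> k) y\<close> in \<open>\<tau>\<close> as \<open>l \<rightarrow> 0+\<close>. They form an \<open>L\<^sup>1\<close>-closed subspace, because \<open>\<tau>\<close> is coarser
  than the norm topology, and this subspace is invariant under dilations of the variable. The indicator
  of \<open>[0,1]\<close> belongs to it iff the Cesaro means of \<open>x\<close> tend to \<open>y\<close>, and \<open>exp (-t)\<close> iff
  \<open>\<mu> R(\<mu>,A) x\<close> does. Step functions approximate \<open>exp (-t)\<close> in \<open>L\<^sup>1\<close>, and by Weierstrass
  (Karamata's argument) linear combinations of \<open>exp (-n t)\<close>, \<open>n \<ge> 1\<close>, approximate the indicator, so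
  the two conditions are equivalent.
\<close>

subsection \<open>Locally convex topologies\<close>

text \<open>The integral of \<open>k(t) T(t) x\<close> is taken weakly: \<open>v\<close> is its
  value if \<open>\<psi> v\<close> is the Lebesgue integral of \<open>k(t) \<psi>(T(t) x)\<close>
  for every test functional \<open>\<psi>\<close>. The obstacle is that \<open>T(h)\<close> need not
  be \<tau>-continuous: bi-continuity speaks only of norm-bounded \<tau>-convergent sequences. The
  test functionals are therefore the norm-bounded ones that respect the limits of such sequences.
  Since the dual is norming, the integral has norm at most the L1 norm of \<open>k\<close> times the
  norm of \<open>x\<close>. Dilation preserves the L1 norm, so an approximation of kernels controls
  the vectors uniformly in \<open>l\<close>; this is what makes the subspace closed. The same
  estimate yields the existence of the Laplace integral without an improper \<tau>-Riemann integral.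
  The resolvent is defined as an inverse of \<mu> - A, so its Laplace formula must be proved.
  Difference quotients of the Laplace integral give surjectivity; taking the Laplace transform of
  the equation A z = \<mu> z gives injectivity.\<close>

locale locally_convex =
  fixes \<tau> :: "'a::real_vector topology"
  assumes locally_convex: "locally_convex_topology \<tau>"
begin

lemma topspace_eq_UNIV [simp]: "topspace \<tau> = UNIV"
  using locally_convex by (simp add: locally_convex_topology_def)

lemma limitin_const_same: "limitin \<tau> (\<lambda>_. y) y F"
  by (simp add: limitin_def)

lemma limitin_add:
  assumes "limitin \<tau> f x F" "limitin \<tau> g y F"
  shows "limitin \<tau> (\<lambda>t. f t + g t) (x + y) F"
proof -
  have "limitin (prod_topology \<tau> \<tau>) (\<lambda>t. (f t, g t)) (x, y) F"
    using assms by (simp add: limitin_pairwise o_def)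
  moreover have "continuous_map (prod_topology \<tau> \<tau>) \<tau> (\<lambda>(x, y). x + y)"
    using locally_convex by (simp add: locally_convex_topology_def)
  ultimately show ?thesis
    by (auto dest: continuous_map_limit simp: o_def)
qed

lemma limitin_scaleR:
  assumes "(c \<longlongrightarrow> a) F" "limitin \<tau> f x F"
  shows "limitin \<tau> (\<lambda>t. c t *\<^sub>R f t) (a *\<^sub>R x) F"
proof -
  have "limitin (prod_topology euclideanreal \<tau>) (\<lambda>t. (c t, f t)) (a, x) F"
    using assms by (simp add: limitin_pairwise o_def)
  moreover have "continuous_map (prod_topology euclideanreal \<tau>) \<tau> (\<lambda>(c, x). c *\<^sub>R x)"
    using locally_convex by (simp add: locally_convex_topology_def)
  ultimately show ?thesis
    by (auto dest: continuous_map_limit simp: o_def)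
qed

lemma continuous_map_scaleR: "continuous_map \<tau> \<tau> (\<lambda>x. c *\<^sub>R x)"
proof -
  have "continuous_map (prod_topology euclideanreal \<tau>) \<tau> (\<lambda>(c, x). c *\<^sub>R x)"
    using locally_convex by (simp add: locally_convex_topology_def)
  moreover have "continuous_map \<tau> (prod_topology euclideanreal \<tau>) (\<lambda>x. (c, x))"
    by (simp add: continuous_map_paired)
  ultimately show ?thesis
    by (auto dest: continuous_map_compose simp: o_def)
qed

lemma limitin_diff:
  assumes "limitin \<tau> f x F" "limitin \<tau> g y F"
  shows "limitin \<tau> (\<lambda>t. f t - g t) (x - y) F"
  using limitin_add[OF assms(1) limitin_scaleR[OF tendsto_const[of "-1"] assms(2)]] by simp

lemma limitin_iff_nhds_0:
  "limitin \<tau> f y F \<longleftrightarrow> (\<forall>U. openin \<tau> U \<and> 0 \<in> U \<longrightarrow> (\<forall>\<^sub>F t in F. f t - y \<in> U))"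
proof
  assume "limitin \<tau> f y F"
  from limitin_diff[OF this limitin_const_same[of y]]
  show "\<forall>U. openin \<tau> U \<and> 0 \<in> U \<longrightarrow> (\<forall>\<^sub>F t in F. f t - y \<in> U)"
    by (simp add: limitin_def)
next
  assume "\<forall>U. openin \<tau> U \<and> 0 \<in> U \<longrightarrow> (\<forall>\<^sub>F t in F. f t - y \<in> U)"
  then have "limitin \<tau> (\<lambda>t. f t - y) 0 F"
    by (simp add: limitin_def)
  from limitin_add[OF this limitin_const_same[of y]] show "limitin \<tau> f y F"
    by simp
qed

text \<open>Replaces the usual halving of epsilon: continuity of addition at (0, 0) gives a product
  neighbourhood, and local convexity shrinks the intersection of its factors.\<close>

lemma convex_nhd_0_half:
  assumes "openin \<tau> U" "0 \<in> U"
  obtains V where "openin \<tau> V" "0 \<in> V" "convex V" "\<And>a b. a \<in> V \<Longrightarrow> b \<in> V \<Longrightarrow> a + b \<in> U"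
proof -
  have "continuous_map (prod_topology \<tau> \<tau>) \<tau> (\<lambda>(x, y). x + y)"
    using locally_convex by (simp add: locally_convex_topology_def)
  then have op: "openin (prod_topology \<tau> \<tau>) {p. (case p of (x, y) \<Rightarrow> x + y) \<in> U}"
    using assms(1) by (auto simp: continuous_map_def)
  have mem: "(0, 0) \<in> {p. (case p of (x, y) \<Rightarrow> x + y) \<in> U}"
    using assms(2) by simp
  obtain A B where AB: "openin \<tau> A" "openin \<tau> B" "0 \<in> A" "0 \<in> B"
    "A \<times> B \<subseteq> {p. (case p of (x, y) \<Rightarrow> x + y) \<in> U}"
    using openin_prod_topology_alt[THEN iffD1, rule_format, OF op mem] by blast
  then have "openin \<tau> (A \<inter> B) \<and> 0 \<in> A \<inter> B"
    by auto
  then obtain V where V: "openin \<tau> V" "convex V" "0 \<in> V" "V \<subseteq> A \<inter> B"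
    using locally_convex unfolding locally_convex_topology_def by meson
  have "a + b \<in> U" if "a \<in> V" "b \<in> V" for a b
  proof -
    have "(a, b) \<in> A \<times> B"
      using that V(4) by auto
    then show ?thesis
      using AB(5) by auto
  qed
  with V(1,3,2) show ?thesis
    by (rule that)
qed

text \<open>Heine-Cantor with compactness used in the interval only, as \<open>\<tau>\<close>
  carries no metric: offending pairs have a subsequence on which both components converge to the
  same point, where continuity contradicts their choice.\<close>

lemma uniformly_continuous_in:
  assumes f: "continuous_map (top_of_set {a..b}) \<tau> f" and U: "openin \<tau> U" "0 \<in> U"
  obtains d where "d > 0"
    "\<And>s t. s \<in> {a..b} \<Longrightarrow> t \<in> {a..b} \<Longrightarrow> \<bar>s - t\<bar> < (d::real) \<Longrightarrow> f s - f t \<in> U"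
proof (rule ccontr)
  assume neg: "\<not> thesis"
  have "\<exists>s\<in>{a..b}. \<exists>t\<in>{a..b}. \<bar>s - t\<bar> < inverse (real (Suc n)) \<and> f s - f t \<notin> U" for n
  proof (rule ccontr)
    assume "\<not> ?thesis"
    then have thesis
      by (intro that[of "inverse (real (Suc n))"]) auto
    with neg show False ..
  qed
  then obtain s t where st: "\<And>n. s n \<in> {a..b}" "\<And>n. t n \<in> {a..b}"
    "\<And>n. \<bar>s n - t n\<bar> < inverse (real (Suc n))" "\<And>n. f (s n) - f (t n) \<notin> U"
    by metis
  obtain l r where l: "l \<in> {a..b}" and r: "strict_mono r" and lim: "(s \<circ> r) \<longlonglongrightarrow> l"
    using compact_Icc[of a b, unfolded compact_def, rule_format, of s] st(1) by auto
  have "(\<lambda>n. s n - t n) \<longlonglongrightarrow> 0"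
    using st(3) by (intro Lim_null_comparison[OF _ LIMSEQ_inverse_real_of_nat])
      (auto intro!: always_eventually less_imp_le)
  then have "((\<lambda>n. s n - t n) \<circ> r) \<longlonglongrightarrow> 0"
    using r by (rule LIMSEQ_subseq_LIMSEQ)
  from tendsto_diff[OF lim this] have lim': "(t \<circ> r) \<longlonglongrightarrow> l"
    by (simp add: o_def)
  have "limitin (top_of_set {a..b}) (s \<circ> r) l sequentially"
    "limitin (top_of_set {a..b}) (t \<circ> r) l sequentially"
    using lim lim' l st(1,2) by (simp_all add: limitin_subtopology)
  from this[THEN continuous_map_limit[OF f]]
  have "limitin \<tau> (f \<circ> (s \<circ> r)) (f l) sequentially" "limitin \<tau> (f \<circ> (t \<circ> r)) (f l) sequentially" .
  from limitin_diff[OF this] have "\<forall>\<^sub>F n in sequentially. f (s (r n)) - f (t (r n)) \<in> U"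
    using U by (simp add: limitin_def o_def)
  then show False
    using st(4) by (auto simp: eventually_sequentially)
qed

end

subsection \<open>Riemann sums and Riemann integrals\<close>

lemma tagged_division_of_IccD:
  assumes "p tagged_division_of {a..b::real}" "x \<in> p"
  shows "fst x \<in> {a..b}" "snd x \<subseteq> {a..b}" "\<exists>c d. snd x = {c..d}"
  using tagged_division_ofD(2-4)[OF assms(1), of "fst x" "snd x"] assms(2) by auto

text \<open>Comes from integrating the indicator of \<open>K\<close> over [a, b] and splitting the
  integral along \<open>q\<close>. It lets a cell of one division be cut by the cells of
  another.\<close>

lemma content_eq_sum_content_Int:
  assumes q: "q tagged_division_of {a..b::real}" and K: "K = {c..d}" "K \<subseteq> {a..b}"
  shows "measure lborel K = (\<Sum>x\<in>q. measure lborel (K \<inter> snd x))"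
proof -
  have int: "integral L (indicator K) = measure lborel (K \<inter> L)" if "L = {u..v}" for L and u v :: real
  proof -
    have "integral L (indicator K) = measure lebesgue (K \<inter> L)"
      unfolding that K by (intro integral_indicator) (simp add: Int_atLeastAtMost)
    also have "\<dots> = measure lborel (K \<inter> L)"
      unfolding that K by (intro measure_completion) auto
    finally show ?thesis .
  qed
  have "integral {a..b} (indicator K :: real \<Rightarrow> real) = (\<Sum>(x, L)\<in>q. integral L (indicator K))"
    using q K unfolding box_real(2)[symmetric]
    by (intro integral_combine_tagged_division_topdown)
      (auto simp: integrable_on_indicator Int_atLeastAtMost)
  also have "\<dots> = (\<Sum>x\<in>q. measure lborel (K \<inter> snd x))"
    unfolding split_beta using int tagged_division_of_IccD(3)[OF q] by (intro sum.cong refl) blast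
  finally show ?thesis
    using int[OF refl, of a b] Int_absorb2[OF K(2)] by simp
qed

definition tagged_sum :: "(real \<Rightarrow> 'a::real_vector) \<Rightarrow> (real \<times> real set) set \<Rightarrow> 'a" where
  "tagged_sum f p = (\<Sum>(s, K)\<in>p. measure lborel K *\<^sub>R f s)"

lemma sum_content_tagged_division:
  assumes "p tagged_division_of {a..b::real}" "a \<le> b"
  shows "(\<Sum>x\<in>p. measure lborel (snd x)) = b - a"
  using additive_content_tagged_division[of p a b] assms by (simp add: split_beta)

lemma tagged_sum_const:
  assumes "p tagged_division_of {a..b::real}" "a \<le> b"
  shows "tagged_sum (\<lambda>_. y) p = (b - a) *\<^sub>R y"
  using sum_content_tagged_division[OF assms]
  by (simp add: tagged_sum_def split_beta flip: scaleR_sum_left)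

text \<open>The contents divided by \<open>b - a\<close> are weights summing to one, so this is a
  convex combination of values of \<open>f\<close>.\<close>

lemma tagged_sum_in_convex:
  assumes p: "p tagged_division_of {a..b::real}" "a < b"
    and C: "convex C" "\<And>s. s \<in> {a..b} \<Longrightarrow> f s \<in> C"
  shows "(1 / (b - a)) *\<^sub>R tagged_sum f p \<in> C"
proof -
  have "(\<Sum>x\<in>p. (measure lborel (snd x) / (b - a)) *\<^sub>R f (fst x)) \<in> C"
    using p C tagged_division_ofD(1)[OF p(1)] tagged_division_of_IccD[OF p(1)]
      sum_content_tagged_division[OF p(1)]
    by (intro convex_sum) (simp_all flip: sum_divide_distrib)
  then show ?thesis
    by (simp add: tagged_sum_def split_beta scaleR_sum_right)
qed

lemma norm_tagged_sum_le:
  fixes f :: "real \<Rightarrow> 'a::real_normed_vector"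
  assumes p: "p tagged_division_of {a..b::real}" "a \<le> b"
    and B: "\<And>s. s \<in> {a..b} \<Longrightarrow> norm (f s) \<le> B"
  shows "norm (tagged_sum f p) \<le> (b - a) * B"
proof -
  have "norm (tagged_sum f p) \<le> (\<Sum>x\<in>p. measure lborel (snd x) * B)"
    unfolding tagged_sum_def split_beta
    using tagged_division_of_IccD[OF p(1)] B
    by (intro sum_norm_le) (auto intro!: mult_left_mono)
  also have "\<dots> = (b - a) * B"
    using sum_content_tagged_division[OF p] by (simp flip: sum_distrib_right)
  finally show ?thesis .
qed

text \<open>Both sums are written over the common refinement.\<close>

lemma tagged_sum_diff_in_convex:
  assumes p: "p tagged_division_of {a..b::real}" "(\<lambda>s. ball s d) fine p"
    and q: "q tagged_division_of {a..b}" "(\<lambda>s. ball s d) fine q"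
    and "a < b" and V: "convex V" "0 \<in> V"
    and f: "\<And>s t. s \<in> {a..b} \<Longrightarrow> t \<in> {a..b} \<Longrightarrow> \<bar>s - t\<bar> < 2 * d \<Longrightarrow> f s - f t \<in> V"
  shows "(1 / (b - a)) *\<^sub>R (tagged_sum f p - tagged_sum f q) \<in> V"
proof -
  define w where "w = (\<lambda>(x::real \<times> real set) (y::real \<times> real set). measure lborel (snd x \<inter> snd y))"
  \<comment> \<open>Cells that do not overlap may have distant tags, so the difference of values
    need not lie in \<open>V\<close>. Their weight is zero, and the default value 0 lies in
    \<open>V\<close>.\<close>
  define z where "z = (\<lambda>(x::real \<times> real set) (y::real \<times> real set). if w x y = 0 then 0 else f (fst x) - f (fst y))"
  have wp: "(\<Sum>y\<in>q. w x y) = measure lborel (snd x)" if "x \<in> p" for x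
  proof -
    obtain c e where "snd x = {c..e}" "snd x \<subseteq> {a..b}"
      using tagged_division_of_IccD[OF p(1) \<open>x \<in> p\<close>] by blast
    then show ?thesis
      unfolding w_def by (metis content_eq_sum_content_Int[OF q(1)])
  qed
  have wq: "(\<Sum>x\<in>p. w x y) = measure lborel (snd y)" if "y \<in> q" for y
  proof -
    obtain c e where "snd y = {c..e}" "snd y \<subseteq> {a..b}"
      using tagged_division_of_IccD[OF q(1) \<open>y \<in> q\<close>] by blast
    then show ?thesis
      unfolding w_def Int_commute[of _ "snd y"] by (metis content_eq_sum_content_Int[OF p(1)])
  qed
  have z: "w x y *\<^sub>R z x y = w x y *\<^sub>R f (fst x) - w x y *\<^sub>R f (fst y)" for x y
    by (simp add: z_def scaleR_diff_right)
  have "tagged_sum f p - tagged_sum f q =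
      (\<Sum>x\<in>p. \<Sum>y\<in>q. w x y *\<^sub>R f (fst x)) - (\<Sum>y\<in>q. \<Sum>x\<in>p. w x y *\<^sub>R f (fst y))"
    by (simp add: tagged_sum_def split_beta wp wq flip: scaleR_sum_left)
  also have "\<dots> = (\<Sum>x\<in>p. \<Sum>y\<in>q. w x y *\<^sub>R z x y)"
    unfolding sum.swap[of _ p q] z by (simp add: sum_subtractf)
  also have "\<dots> = (\<Sum>u\<in>p \<times> q. w (fst u) (snd u) *\<^sub>R z (fst u) (snd u))"
    by (simp add: sum.cartesian_product split_beta)
  finally have eq: "(1 / (b - a)) *\<^sub>R (tagged_sum f p - tagged_sum f q) =
      (\<Sum>u\<in>p \<times> q. (w (fst u) (snd u) / (b - a)) *\<^sub>R z (fst u) (snd u))"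
    by (simp add: scaleR_sum_right)
  have zV: "z x y \<in> V" if "x \<in> p" "y \<in> q" for x y
  proof (cases "w x y = 0")
    case False
    \<comment> \<open>A common point lies within \<open>d\<close> of both tags; this is the origin
      of \<open>2 * d\<close> in the hypothesis on \<open>f\<close>.\<close>
    then obtain t where t: "t \<in> snd x" "t \<in> snd y"
      unfolding w_def by (metis IntE ex_in_conv measure_empty)
    have "snd x \<subseteq> ball (fst x) d" "snd y \<subseteq> ball (fst y) d"
      using fineD[OF p(2), of "fst x" "snd x"] fineD[OF q(2), of "fst y" "snd y"] that by auto
    with t have "\<bar>fst x - fst y\<bar> < 2 * d"
      by (force simp: dist_real_def)
    then show ?thesis
      using f tagged_division_of_IccD(1)[OF p(1)] tagged_division_of_IccD(1)[OF q(1)] that False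
      by (simp add: z_def)
  qed (simp add: z_def V)
  have "(\<Sum>u\<in>p \<times> q. w (fst u) (snd u)) = b - a"
    using sum_content_tagged_division[OF p(1)] \<open>a < b\<close>
    by (simp add: sum.cartesian_product' wp)
  then show ?thesis
    unfolding eq using \<open>a < b\<close> V(1) zV tagged_division_ofD(1)[OF p(1)] tagged_division_ofD(1)[OF q(1)]
    by (intro convex_sum) (auto simp: w_def simp flip: sum_divide_distrib)
qed

context locally_convex
begin

text \<open>Once "mesh tends to zero" is expressed as a filter on tagged divisions, the Riemann
  integral is an ordinary limit, and the translation to neighbourhoods of 0 applies to it.\<close>

lemma has_Riemann_integral_in_iff:
  "has_Riemann_integral_in \<tau> f y a b \<longleftrightarrow>
    (\<forall>U. openin \<tau> U \<and> 0 \<in> U \<longrightarrow> (\<exists>\<delta>>0. \<forall>p. p tagged_division_of {a..b} \<and> (\<lambda>s. ball s \<delta>) fine p \<longrightarrow>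
       tagged_sum f p - y \<in> U))" (is "_ \<longleftrightarrow> ?R")
proof -
  let ?F = "INF \<delta>\<in>{0<..}. principal {p. p tagged_division_of {a..b} \<and> (\<lambda>s. ball s \<delta>) fine p}"
  have ev: "eventually P ?F \<longleftrightarrow> (\<exists>\<delta>>0. \<forall>p. p tagged_division_of {a..b} \<and> (\<lambda>s. ball s \<delta>) fine p \<longrightarrow> P p)" for P
  proof -
    have "eventually P ?F \<longleftrightarrow> (\<exists>\<delta>\<in>{0<..}. eventually P (principal {p. p tagged_division_of {a..b} \<and> (\<lambda>s. ball s \<delta>) fine p}))"
    proof (intro eventually_INF_base)
      fix d e :: real assume "d \<in> {0<..}" "e \<in> {0<..}"
      then show "\<exists>c\<in>{0<..}. principal {p. p tagged_division_of {a..b} \<and> (\<lambda>s. ball s c) fine p}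
        \<le> inf (principal {p. p tagged_division_of {a..b} \<and> (\<lambda>s. ball s d) fine p})
            (principal {p. p tagged_division_of {a..b} \<and> (\<lambda>s. ball s e) fine p})"
        by (intro bexI[of _ "min d e"]) (auto simp: fine_def subset_iff)
    qed auto
    then show ?thesis
      by (auto simp: eventually_principal)
  qed
  have "has_Riemann_integral_in \<tau> f y a b \<longleftrightarrow> limitin \<tau> (tagged_sum f) y ?F"
    unfolding has_Riemann_integral_in_def limitin_def ev tagged_sum_def by simp
  also have "\<dots> \<longleftrightarrow> ?R"
    unfolding limitin_iff_nhds_0 ev ..
  finally show ?thesis .
qed

text \<open>The partitions may be refined along any further gauge; this gives access to the
  Henstock--Kurzweil integral of each functional of the integrand.\<close>

lemma Riemann_integral_sequence:
  assumes f: "has_Riemann_integral_in \<tau> f y a b" and g: "\<And>n. gauge (g n)"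
  shows "\<exists>p. (\<forall>n. p n tagged_division_of {a..b} \<and> g n fine p n) \<and>
    limitin \<tau> (\<lambda>n. tagged_sum f (p n)) y sequentially"
proof -
  \<comment> \<open>Intersecting the gauges makes one sequence serve two purposes: mesh tending to
    zero, and fineness for \<open>g n\<close>.\<close>
  have "\<exists>p. p tagged_division_of {a..b} \<and> (\<lambda>s. g n s \<inter> ball s (inverse (real (Suc n)))) fine p" for n
    using fine_division_exists_real[OF gauge_Int[OF g gauge_ball]] by (metis inverse_positive_iff_positive of_nat_0_less_iff zero_less_Suc)
  then obtain p where p: "\<And>n. p n tagged_division_of {a..b}"
    "\<And>n. (\<lambda>s. g n s \<inter> ball s (inverse (real (Suc n)))) fine p n"
    by metis
  have "limitin \<tau> (\<lambda>n. tagged_sum f (p n)) y sequentially"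
    unfolding limitin_iff_nhds_0
  proof safe
    fix U assume "openin \<tau> U" "0 \<in> U"
    then obtain \<delta> where \<delta>: "\<delta> > 0"
      "\<And>p. p tagged_division_of {a..b} \<Longrightarrow> (\<lambda>s. ball s \<delta>) fine p \<Longrightarrow> tagged_sum f p - y \<in> U"
      using f unfolding has_Riemann_integral_in_iff by meson
    have "\<forall>\<^sub>F n in sequentially. inverse (real (Suc n)) < \<delta>"
      using LIMSEQ_inverse_real_of_nat \<delta>(1) by (rule order_tendstoD)
    then show "\<forall>\<^sub>F n in sequentially. tagged_sum f (p n) - y \<in> U"
    proof eventually_elim
      case (elim n)
      then have "(\<lambda>s. ball s \<delta>) fine p n"
        using p(2)[of n] unfolding fine_def by force
      then show ?case
        using \<delta>(2) p(1) by blast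
    qed
  qed
  then show ?thesis
    using p by (intro exI[of _ p]) (auto simp: fine_Int)
qed

end

section \<open>Test functionals, and Riemann integrability in the bi-continuous setting\<close>

lemma bounded_linear_if_isCont_0:
  fixes \<phi> :: "'a::real_normed_vector \<Rightarrow> real"
  assumes "linear \<phi>" "isCont \<phi> 0"
  shows "bounded_linear \<phi>"
proof -
  interpret linear \<phi>
    by (fact assms)
  obtain d where d: "d > 0" "\<And>x. norm x < d \<Longrightarrow> \<bar>\<phi> x\<bar> < 1"
    using assms(2)[unfolded continuous_at_eps_delta, rule_format, of 1] by (auto simp: zero)
  have "\<bar>\<phi> x\<bar> \<le> norm x * (2 / d)" for x
  proof (cases "x = 0")
    case False
    have "\<bar>\<phi> ((d / (2 * norm x)) *\<^sub>R x)\<bar> < 1"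
      using d(1) False by (intro d(2)) auto
    then show ?thesis
      using d(1) False by (simp add: scale abs_mult field_simps)
  qed (simp add: zero)
  then show ?thesis
    by unfold_locales (auto simp: add scale intro!: exI[of _ "2 / d"])
qed

locale bicontinuous_space =
  fixes \<tau> :: "'a::banach topology"
  assumes setting: "bicontinuous_setting \<tau>"
begin

sublocale locally_convex \<tau>
  using setting by unfold_locales (simp add: bicontinuous_setting_def)

lemma tendsto_imp_limitin: "(f \<longlongrightarrow> y) F \<Longrightarrow> limitin \<tau> f y F"
  using setting by (simp add: bicontinuous_setting_def limitin_def tendsto_def)

text \<open>Contains the dual of \<open>\<tau>\<close>. Composing an element of the dual with
  \<open>T(h)\<close> may destroy \<tau>-continuity, but this weaker, sequential condition
  survives.\<close>

definition seq_functional :: "('a \<Rightarrow> real) \<Rightarrow> bool" where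
  "seq_functional \<psi> \<longleftrightarrow> bounded_linear \<psi> \<and>
     (\<forall>X y. bounded (range X) \<and> limitin \<tau> X y sequentially \<longrightarrow> (\<lambda>n. \<psi> (X n)) \<longlonglongrightarrow> \<psi> y)"

lemma seq_functional_bounded_linear: "seq_functional \<psi> \<Longrightarrow> bounded_linear \<psi>"
  by (simp add: seq_functional_def)

lemma seq_functional_tendsto:
  "seq_functional \<psi> \<Longrightarrow> (\<And>n. norm (X n) \<le> B) \<Longrightarrow> limitin \<tau> X y sequentially \<Longrightarrow>
    (\<lambda>n. \<psi> (X n)) \<longlonglongrightarrow> \<psi> y"
  unfolding seq_functional_def bounded_iff by blast

lemma dual_limitin:
  assumes "\<phi> \<in> topological_dual \<tau>" "limitin \<tau> f y F"
  shows "((\<lambda>t. \<phi> (f t)) \<longlongrightarrow> \<phi> y) F"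
  using assms continuous_map_limit[of \<tau> euclideanreal \<phi> f y F]
  by (simp add: topological_dual_def o_def)

lemma dual_seq_functional:
  assumes "\<phi> \<in> topological_dual \<tau>"
  shows "seq_functional \<phi>"
proof -
  have "isCont \<phi> 0"
    unfolding isCont_def by (intro dual_limitin[OF assms] tendsto_imp_limitin) simp
  then have "bounded_linear \<phi>"
    using assms unfolding topological_dual_def by (blast intro: bounded_linear_if_isCont_0)
  then show ?thesis
    unfolding seq_functional_def using dual_limitin[OF assms] by blast
qed

lemma norm_le_dual:
  assumes "\<And>\<phi>. \<phi> \<in> topological_dual \<tau> \<Longrightarrow> onorm \<phi> \<le> 1 \<Longrightarrow> \<bar>\<phi> x\<bar> \<le> B"
  shows "norm x \<le> B"
proof -
  \<comment> \<open>The zero functional makes the index set of the supremum nonempty, as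
    \<open>cSUP_least\<close> demands.\<close>
  have "(\<lambda>_. 0) \<in> {\<phi> \<in> topological_dual \<tau>. onorm \<phi> \<le> 1}"
    by (simp add: topological_dual_def linear_zero onorm_zero)
  then have "(SUP \<phi>\<in>{\<phi> \<in> topological_dual \<tau>. onorm \<phi> \<le> 1}. \<bar>\<phi> x\<bar>) \<le> B"
    using assms by (intro cSUP_least) auto
  then show ?thesis
    using setting by (simp add: bicontinuous_setting_def)
qed

text \<open>A norming set of functionals separates points; uniqueness of \<tau>-limits and of weak
  integrals rests on this.\<close>

lemma eq_if_dual_eq:
  assumes "\<And>\<phi>. \<phi> \<in> topological_dual \<tau> \<Longrightarrow> \<phi> x = \<phi> y"
  shows "x = y"
proof -
  have "norm (x - y) \<le> 0"
    using assms by (intro norm_le_dual) (simp add: topological_dual_def linear_diff)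
  then show ?thesis
    by simp
qed

lemma limitin_unique:
  assumes "limitin \<tau> f y F" "limitin \<tau> f z F" "F \<noteq> bot"
  shows "y = z"
proof (rule eq_if_dual_eq)
  fix \<phi> assume "\<phi> \<in> topological_dual \<tau>"
  then show "\<phi> y = \<phi> z"
    using tendsto_unique[OF assms(3)] dual_limitin assms(1,2) by blast
qed

lemma Lim_in_eq:
  assumes "limitin \<tau> f y F" "F \<noteq> bot"
  shows "Lim_in \<tau> F f = y"
  unfolding Lim_in_def using assms limitin_unique by (intro the_equality) auto

text \<open>Sequences suffice to test continuity on a set of reals, and the bound on
  \<open>f\<close> makes the image sequences admissible for \<open>\<psi>\<close>.\<close>

lemma continuous_on_seq_functional:
  assumes \<psi>: "seq_functional \<psi>" and f: "continuous_map (top_of_set S) \<tau> f"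
    and B: "\<And>s. s \<in> S \<Longrightarrow> norm (f s) \<le> B"
  shows "continuous_on S (\<lambda>s::real. \<psi> (f s))"
  unfolding continuous_on_sequentially
proof (intro allI ballI impI)
  fix X s assume s: "s \<in> S" and X: "(\<forall>n. X n \<in> S) \<and> X \<longlonglongrightarrow> s"
  then have "limitin (top_of_set S) X s sequentially"
    by (simp add: limitin_subtopology)
  from continuous_map_limit[OF f this] show "((\<lambda>s. \<psi> (f s)) \<circ> X) \<longlonglongrightarrow> \<psi> (f s)"
    using X B unfolding o_def by (intro seq_functional_tendsto[OF \<psi>, of _ B]) auto
qed

lemma seq_functional_tagged_sum:
  assumes "seq_functional \<psi>"
  shows "\<psi> (tagged_sum f p) = tagged_sum (\<lambda>s. \<psi> (f s)) p"
proof -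
  interpret bounded_linear \<psi>
    using assms by (rule seq_functional_bounded_linear)
  show ?thesis
    by (simp add: tagged_sum_def sum scaleR split_beta)
qed

text \<open>The scalar integral exists by continuity. To identify it with \<open>\<psi> y\<close>,
  tagged sums are taken along divisions fine for the gauges of the scalar integral as well:
  \<open>\<psi>\<close> of them then has both limits.\<close>

lemma has_integral_seq_functional:
  assumes y: "has_Riemann_integral_in \<tau> f y a b" and "a \<le> b"
    and f: "continuous_map (top_of_set {a..b}) \<tau> f" and B: "\<And>s. s \<in> {a..b} \<Longrightarrow> norm (f s) \<le> B"
    and \<psi>: "seq_functional \<psi>"
  shows "((\<lambda>s. \<psi> (f s)) has_integral \<psi> y) {a..b}"
proof -
  let ?I = "integral {a..b} (\<lambda>s. \<psi> (f s))"
  have int: "((\<lambda>s. \<psi> (f s)) has_integral ?I) {a..b}"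
    using continuous_on_seq_functional[OF \<psi> f B] integrable_continuous_interval by blast
  have "\<exists>\<gamma>. gauge \<gamma> \<and> (\<forall>p. p tagged_division_of {a..b} \<and> \<gamma> fine p \<longrightarrow>
      \<bar>tagged_sum (\<lambda>s. \<psi> (f s)) p - ?I\<bar> < inverse (real (Suc n)))" for n
    using int[unfolded has_integral_real] by (force simp: tagged_sum_def)
  then obtain g where g: "\<And>n. gauge (g n)"
    "\<And>n p. p tagged_division_of {a..b} \<Longrightarrow> g n fine p \<Longrightarrow>
      \<bar>tagged_sum (\<lambda>s. \<psi> (f s)) p - ?I\<bar> < inverse (real (Suc n))"
    by metis
  obtain p where "\<forall>n. p n tagged_division_of {a..b} \<and> g n fine p n"
    and lim: "limitin \<tau> (\<lambda>n. tagged_sum f (p n)) y sequentially"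
    using Riemann_integral_sequence[where g = g, OF y g(1)] by blast
  then have p: "p n tagged_division_of {a..b}" "g n fine p n" for n
    by auto
  have lim1: "(\<lambda>n. \<psi> (tagged_sum f (p n))) \<longlonglongrightarrow> \<psi> y"
    using norm_tagged_sum_le[OF p(1) \<open>a \<le> b\<close> B] lim by (intro seq_functional_tendsto[OF \<psi>]) auto
  have lim2: "(\<lambda>n. \<psi> (tagged_sum f (p n)) - ?I) \<longlonglongrightarrow> 0"
    using g(2)[OF p(1,2)] unfolding seq_functional_tagged_sum[OF \<psi>]
    by (intro Lim_null_comparison[OF _ LIMSEQ_inverse_real_of_nat])
      (auto intro!: always_eventually less_imp_le)
  have "\<psi> y = ?I"
    by (rule LIMSEQ_unique[OF lim1 LIM_zero_cancel[OF lim2]])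
  with int show ?thesis
    by simp
qed

text \<open>Completeness is available only for norm-bounded Cauchy sequences, not for nets. So the
  limit is found along one sequence of divisions, and the Cauchy estimate then carries it over to
  all sufficiently fine ones.\<close>

lemma Riemann_integrable_in:
  assumes "a < b" and f: "continuous_map (top_of_set {a..b}) \<tau> f"
    and B: "\<And>s. s \<in> {a..b} \<Longrightarrow> norm (f s) \<le> B"
  obtains y where "has_Riemann_integral_in \<tau> f y a b"
proof -
  have close: "\<exists>d>0. \<forall>p q. p tagged_division_of {a..b} \<and> (\<lambda>s. ball s d) fine p \<and>
      q tagged_division_of {a..b} \<and> (\<lambda>s. ball s d) fine q \<longrightarrow> tagged_sum f p - tagged_sum f q \<in> U"
    if U: "openin \<tau> U" "0 \<in> U" for U
  proof -
    have "continuous_map \<tau> \<tau> (\<lambda>x. (b - a) *\<^sub>R x)"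
      by (rule continuous_map_scaleR)
    \<comment> \<open>The convexity argument controls differences of tagged sums only after division
      by \<open>b - a\<close>; the preimage undoes this scaling.\<close>
    then have "openin \<tau> {x. (b - a) *\<^sub>R x \<in> U}" "0 \<in> {x. (b - a) *\<^sub>R x \<in> U}"
      using U by (auto simp: continuous_map_def)
    then obtain V where V: "openin \<tau> V" "convex V" "0 \<in> V" "V \<subseteq> {x. (b - a) *\<^sub>R x \<in> U}"
      using locally_convex unfolding locally_convex_topology_def by meson
    obtain e where e: "e > 0" "\<And>s t. s \<in> {a..b} \<Longrightarrow> t \<in> {a..b} \<Longrightarrow> \<bar>s - t\<bar> < e \<Longrightarrow> f s - f t \<in> V"
      using uniformly_continuous_in[OF f V(1,3)] by blast
    show ?thesis
    \<comment> \<open>Mesh \<open>e / 2\<close>, because overlapping cells have tags less than twice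
      the mesh apart.\<close>
    proof (intro exI[of _ "e / 2"] conjI allI impI)
      fix p q assume "p tagged_division_of {a..b} \<and> (\<lambda>s. ball s (e / 2)) fine p \<and>
        q tagged_division_of {a..b} \<and> (\<lambda>s. ball s (e / 2)) fine q"
      then have "(1 / (b - a)) *\<^sub>R (tagged_sum f p - tagged_sum f q) \<in> V"
        using e(2) V \<open>a < b\<close> by (intro tagged_sum_diff_in_convex[of p a b "e / 2"]) auto
      then show "tagged_sum f p - tagged_sum f q \<in> U"
        using V(4) \<open>a < b\<close> by auto
    qed (use e in simp)
  qed
  have "\<exists>p. p tagged_division_of {a..b} \<and> (\<lambda>s. ball s (inverse (real (Suc n)))) fine p" for n
    using fine_division_exists_real[OF gauge_ball] by (metis inverse_positive_iff_positive of_nat_0_less_iff zero_less_Suc)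
  then obtain p where p: "\<And>n. p n tagged_division_of {a..b}"
    "\<And>n. (\<lambda>s. ball s (inverse (real (Suc n)))) fine p n"
    by metis
  have fine: "\<exists>N. \<forall>n\<ge>N. (\<lambda>s. ball s d) fine p n" if "d > 0" for d
  proof -
    have "\<forall>\<^sub>F n in sequentially. inverse (real (Suc n)) < d"
      using LIMSEQ_inverse_real_of_nat that by (rule order_tendstoD)
    then have "\<forall>\<^sub>F n in sequentially. (\<lambda>s. ball s d) fine p n"
    proof eventually_elim
      case (elim n)
      then show ?case
        using p(2)[of n] unfolding fine_def by force
    qed
    then show ?thesis
      by (simp add: eventually_sequentially)
  qed
  have "Cauchy_in \<tau> (\<lambda>n. tagged_sum f (p n))"
    unfolding Cauchy_in_def
  proof (intro allI impI)
    fix U assume "openin \<tau> U \<and> 0 \<in> U"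
    then obtain d where d: "d > 0" "\<And>p q. p tagged_division_of {a..b} \<Longrightarrow> (\<lambda>s. ball s d) fine p \<Longrightarrow>
      q tagged_division_of {a..b} \<Longrightarrow> (\<lambda>s. ball s d) fine q \<Longrightarrow> tagged_sum f p - tagged_sum f q \<in> U"
      using close[of U] by meson
    then show "\<exists>N. \<forall>m\<ge>N. \<forall>n\<ge>N. tagged_sum f (p m) - tagged_sum f (p n) \<in> U"
      using fine[OF d(1)] p(1) by meson
  qed
  moreover have "bounded (range (\<lambda>n. tagged_sum f (p n)))"
    unfolding bounded_iff using norm_tagged_sum_le[OF p(1) _ B] \<open>a < b\<close> by (auto intro!: exI)
  ultimately obtain y where y: "limitin \<tau> (\<lambda>n. tagged_sum f (p n)) y sequentially"
    using setting unfolding bicontinuous_setting_def by blast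
  have "has_Riemann_integral_in \<tau> f y a b"
    unfolding has_Riemann_integral_in_iff
  proof (intro allI impI)
    fix U assume "openin \<tau> U \<and> 0 \<in> U"
    then obtain V where V: "openin \<tau> V" "0 \<in> V" "\<And>u v. u \<in> V \<Longrightarrow> v \<in> V \<Longrightarrow> u + v \<in> U"
      using convex_nhd_0_half by metis
    obtain d where d: "d > 0" "\<And>p q. p tagged_division_of {a..b} \<Longrightarrow> (\<lambda>s. ball s d) fine p \<Longrightarrow>
      q tagged_division_of {a..b} \<Longrightarrow> (\<lambda>s. ball s d) fine q \<Longrightarrow> tagged_sum f p - tagged_sum f q \<in> V"
      using close[OF V(1,2)] by meson
    obtain N where N: "\<And>n. n \<ge> N \<Longrightarrow> tagged_sum f (p n) - y \<in> V"
      using y V unfolding limitin_iff_nhds_0 eventually_sequentially by meson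
    obtain M where M: "\<And>n. n \<ge> M \<Longrightarrow> (\<lambda>s. ball s d) fine p n"
      using fine[OF d(1)] by blast
    have "tagged_sum f q - y \<in> U" if q: "q tagged_division_of {a..b}" "(\<lambda>s. ball s d) fine q" for q
    proof -
      have "(tagged_sum f q - tagged_sum f (p (max M N))) + (tagged_sum f (p (max M N)) - y) \<in> U"
        by (intro V(3) d(2) q p(1) M N) auto
      then show ?thesis
        by simp
    qed
    with d(1) show "\<exists>\<delta>>0. \<forall>p. p tagged_division_of {a..b} \<and> (\<lambda>s. ball s \<delta>) fine p \<longrightarrow> tagged_sum f p - y \<in> U"
      by blast
  qed
  then show ?thesis
    by (rule that)
qed

end

subsection \<open>Subspaces of \<open>L\<^sup>1\<close> containing indicators or exponentials\<close>

text \<open>Interpreted twice for a fixed \<open>x\<close>: by the kernels whose integral along the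
  orbit exists, and by those whose rescaled integrals have the right limit.\<close>

locale L1_subspace =
  fixes K :: "(real \<Rightarrow> real) set"
  assumes integrable: "f \<in> K \<Longrightarrow> integrable lborel f"
    and zero: "(\<lambda>_. 0) \<in> K"
    and add: "f \<in> K \<Longrightarrow> g \<in> K \<Longrightarrow> (\<lambda>t. f t + g t) \<in> K"
    and scale: "f \<in> K \<Longrightarrow> (\<lambda>t. c * f t) \<in> K"
    and closed: "integrable lborel f \<Longrightarrow> (\<And>e. e > 0 \<Longrightarrow> \<exists>g\<in>K. (\<integral>t. \<bar>f t - g t\<bar> \<partial>lborel) < e) \<Longrightarrow> f \<in> K"
begin

lemma sum:
  assumes "\<And>i. i \<in> I \<Longrightarrow> f i \<in> K"
  shows "(\<lambda>t. \<Sum>i\<in>I. f i t) \<in> K"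
  using assms by (induction I rule: infinite_finite_induct) (simp_all add: zero add)

text \<open>Dominated convergence, with majorant \<open>\<bar>f t\<bar> + w t\<close> for the
  difference, turns pointwise into L1 convergence, to which closedness applies.\<close>

lemma dominated_limit:
  assumes s: "\<And>n. s n \<in> K" and [measurable]: "f \<in> borel_measurable lborel" and w: "integrable lborel w"
    and lim: "AE t in lborel. (\<lambda>n. s n t) \<longlonglongrightarrow> f t"
    and bound: "\<And>n t. \<bar>s n t\<bar> \<le> w t"
  shows "f \<in> K"
proof (rule closed)
  have [measurable]: "s n \<in> borel_measurable lborel" for n
    using integrable[OF s] by simp
  show f: "integrable lborel f"
    by (rule integrable_dominated_convergence[where s = s and w = w])
      (use w lim bound in auto)
  have "(\<lambda>n. \<integral>t. \<bar>f t - s n t\<bar> \<partial>lborel) \<longlonglongrightarrow> (\<integral>(t::real). 0 \<partial>lborel)"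
  proof (rule integral_dominated_convergence[where w = "\<lambda>t. \<bar>f t\<bar> + w t"])
    show "AE t in lborel. (\<lambda>n. \<bar>f t - s n t\<bar>) \<longlonglongrightarrow> 0"
      using lim
    proof eventually_elim
      case (elim t)
      then have "(\<lambda>n. \<bar>f t - s n t\<bar>) \<longlonglongrightarrow> \<bar>f t - f t\<bar>"
        by (intro tendsto_intros)
      then show ?case
        by simp
    qed
    show "integrable lborel (\<lambda>t. \<bar>f t\<bar> + w t)"
      using f w by (intro Bochner_Integration.integrable_add integrable_abs)
    fix n
    have "norm \<bar>f t - s n t\<bar> \<le> \<bar>f t\<bar> + w t" for t
      using bound[of n t] by simp
    then show "AE t in lborel. norm \<bar>f t - s n t\<bar> \<le> \<bar>f t\<bar> + w t"
      by simp
  qed simp_all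
  then have lim0: "(\<lambda>n. \<integral>t. \<bar>f t - s n t\<bar> \<partial>lborel) \<longlonglongrightarrow> 0"
    by simp
  fix e :: real assume "e > 0"
  from order_tendstoD(2)[OF lim0 this] show "\<exists>g\<in>K. (\<integral>t. \<bar>f t - g t\<bar> \<partial>lborel) < e"
    using s by (auto simp: eventually_sequentially)
qed

end

definition exp_kernel :: "real \<Rightarrow> real \<Rightarrow> real" where
  "exp_kernel \<mu> t = indicator {0..} t * exp (- (\<mu> * t))"

lemma has_bochner_integral_exp_kernel:
  assumes "\<mu> > 0"
  shows "has_bochner_integral lborel (exp_kernel \<mu>) (1 / \<mu>)"
proof (rule has_bochner_integral_nn_integral)
  have "((\<lambda>t. exp (- (\<mu> * t))) \<longlongrightarrow> 0) at_top"
    using assms by real_asymp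
  then have "((\<lambda>t. - exp (- (\<mu> * t)) / \<mu>) \<longlongrightarrow> 0) at_top"
    using tendsto_divide[of "\<lambda>t. - exp (- (\<mu> * t))" 0 at_top "\<lambda>_. \<mu>" \<mu>] assms tendsto_minus by fastforce
  then have "(\<integral>\<^sup>+t. ennreal (exp (- (\<mu> * t))) * indicator {0..} t \<partial>lborel) = ennreal (0 - (- exp (- (\<mu> * 0)) / \<mu>))"
    using assms by (intro nn_integral_FTC_atLeast) (auto intro!: derivative_eq_intros)
  then show "(\<integral>\<^sup>+t. ennreal (exp_kernel \<mu> t) \<partial>lborel) = ennreal (1 / \<mu>)"
    by (simp add: exp_kernel_def mult.commute ennreal_mult'' ennreal_indicator)
qed (use assms in \<open>auto simp: exp_kernel_def[abs_def]\<close>)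

lemma integrable_exp_kernel: "\<mu> > 0 \<Longrightarrow> integrable lborel (exp_kernel \<mu>)"
  and integral_exp_kernel: "\<mu> > 0 \<Longrightarrow> (\<integral>t. exp_kernel \<mu> t \<partial>lborel) = 1 / \<mu>"
  using has_bochner_integral_exp_kernel has_bochner_integral_iff by blast+

lemma exp_kernel_nonneg: "exp_kernel \<mu> t \<ge> 0"
  by (simp add: exp_kernel_def)

lemma (in L1_subspace) exp_kernel_mem:
  assumes "\<And>r. r > 0 \<Longrightarrow> indicator {0..r} \<in> K" and "\<mu> > 0"
  shows "exp_kernel \<mu> \<in> K"
proof -
  \<comment> \<open>The first cell of the step function below has left endpoint 0, which the
    hypothesis on \<open>r > 0\<close> misses. The degenerate indicator is a null function, so it is
    approximated by 0.\<close>
  have "indicator {0..0} \<in> K"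
  proof (rule closed)
    show "\<exists>g\<in>K. (\<integral>t. \<bar>indicator {0..0} t - g t\<bar> \<partial>lborel) < e" if "e > 0" for e
      using zero that by (intro bexI[of _ "\<lambda>_. 0"]) auto
  qed simp
  then have ind: "indicator {0..r} \<in> K" if "r \<ge> 0" for r
    using assms(1) that by (cases "r = 0") auto
  \<comment> \<open>A step function with cells of width \<open>1 / Suc n\<close>, open on the left;
    \<open>(Suc n)\<^sup>2\<close> of them fill the interval from 0 to \<open>Suc n\<close>. The
    value at the right endpoint of each cell keeps \<open>s n\<close> below the decreasing kernel,
    so that the kernel is its own majorant.\<close>
  define s where "s = (\<lambda>n t. \<Sum>i<(Suc n)\<^sup>2. exp (- (\<mu> * (real (Suc i) / real (Suc n)))) *
    (indicator {0..real (Suc i) / real (Suc n)} t + (- 1) * indicator {0..real i / real (Suc n)} t))"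
  \<comment> \<open>The ceiling is the number of the cell containing \<open>t\<close>, counted from
    1.\<close>
  have s_eq: "s n t = (if 0 < \<lceil>t * real (Suc n)\<rceil> \<and> \<lceil>t * real (Suc n)\<rceil> \<le> (Suc n)\<^sup>2
      then exp (- (\<mu> * (\<lceil>t * real (Suc n)\<rceil> / Suc n))) else 0)" for n t
  proof -
    have "indicator {0..real (Suc i) / real (Suc n)} t + (- 1) * indicator {0..real i / real (Suc n)} t
        = (if \<lceil>t * real (Suc n)\<rceil> = int (Suc i) then 1 else 0 :: real)" for i
    proof (cases "0 < t")
      case True
      then show ?thesis
        by (auto simp: indicator_def ceiling_eq_iff field_simps)
    next
      case False
      then have "t * real (Suc n) \<le> 0"
        by (simp add: mult_nonpos_nonneg)
      then have "\<lceil>t * real (Suc n)\<rceil> \<noteq> int (Suc i)"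
        by (simp add: ceiling_eq_iff del: of_nat_Suc)
      with False show ?thesis
        by (auto simp: indicator_def)
    qed
    then have "s n t = (\<Sum>i<(Suc n)\<^sup>2. if \<lceil>t * real (Suc n)\<rceil> = int (Suc i)
        then exp (- (\<mu> * (real (Suc i) / real (Suc n)))) else 0)"
      unfolding s_def by (intro sum.cong) auto
    also have "\<dots> = (if 0 < \<lceil>t * real (Suc n)\<rceil> \<and> \<lceil>t * real (Suc n)\<rceil> \<le> (Suc n)\<^sup>2
      then exp (- (\<mu> * (\<lceil>t * real (Suc n)\<rceil> / Suc n))) else 0)"
    proof (cases "0 < \<lceil>t * real (Suc n)\<rceil>")
      case True
      then obtain j where j: "\<lceil>t * real (Suc n)\<rceil> = int (Suc j)"
        by (metis Suc_pred' zero_less_imp_eq_int of_nat_0_less_iff)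
      show ?thesis
        unfolding j by (auto simp: sum.delta simp flip: of_nat_power)
    next
      case False
      then have "\<lceil>t * real (Suc n)\<rceil> \<noteq> int (Suc i)" for i
        by linarith
      with False show ?thesis
        by simp
    qed
    finally show ?thesis .
  qed
  show ?thesis
  proof (rule dominated_limit)
    show "s n \<in> K" for n
      unfolding s_def by (intro sum scale add ind) auto
    show "integrable lborel (exp_kernel \<mu>)"
      using \<open>\<mu> > 0\<close> by (rule integrable_exp_kernel)
    show "exp_kernel \<mu> \<in> borel_measurable lborel"
      by (auto simp: exp_kernel_def[abs_def])
    show "\<bar>s n t\<bar> \<le> exp_kernel \<mu> t" for n t
    proof (cases "0 < \<lceil>t * real (Suc n)\<rceil>")
      case True
      then have "t > 0"
        by (simp add: zero_less_mult_iff)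
      moreover have "t \<le> \<lceil>t * real (Suc n)\<rceil> / Suc n"
        by (simp add: pos_le_divide_eq)
      then have "\<mu> * t \<le> \<mu> * (\<lceil>t * real (Suc n)\<rceil> / Suc n)"
        using \<open>\<mu> > 0\<close> by (intro mult_left_mono) auto
      ultimately show ?thesis
        by (simp add: s_eq exp_kernel_def del: times_divide_eq_right)
    qed (simp add: s_eq exp_kernel_nonneg)
    \<comment> \<open>At 0 every \<open>s n\<close> vanishes while the kernel equals 1.\<close>
    have "(\<lambda>n. s n t) \<longlonglongrightarrow> exp_kernel \<mu> t" if "t \<noteq> 0" for t
    proof (cases "t > 0")
      case False
      with that have "s n t = 0" for n
        by (simp add: s_eq zero_less_mult_iff)
      with False that show ?thesis
        by (simp add: exp_kernel_def)
    next
      case True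
      have "(\<lambda>n. of_int \<lceil>t * real (Suc n)\<rceil> / real (Suc n)) \<longlonglongrightarrow> t"
        by real_asymp
      then have "(\<lambda>n. exp (- (\<mu> * (of_int \<lceil>t * real (Suc n)\<rceil> / real (Suc n))))) \<longlonglongrightarrow> exp (- (\<mu> * t))"
        by (intro tendsto_intros)
      moreover have "\<forall>\<^sub>F n in sequentially. s n t = exp (- (\<mu> * (of_int \<lceil>t * real (Suc n)\<rceil> / real (Suc n))))"
        using eventually_ge_at_top[of "nat \<lceil>t\<rceil>"]
      proof eventually_elim
        case (elim n)
        then have "t \<le> real (Suc n)"
          by linarith
        then have "t * real (Suc n) \<le> real (Suc n) * real (Suc n)"
          by (intro mult_right_mono) auto
        then have "\<lceil>t * real (Suc n)\<rceil> \<le> (Suc n)\<^sup>2"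
          by (simp only: ceiling_le_iff of_int_of_nat_eq of_int_mult of_nat_mult power2_eq_square)
        then show ?case
          using True by (simp add: s_eq)
      qed
      ultimately show ?thesis
        using True by (simp add: exp_kernel_def tendsto_cong)
    qed
    then show "AE t in lborel. (\<lambda>n. s n t) \<longlonglongrightarrow> exp_kernel \<mu> t"
      using AE_lborel_singleton[of 0] by (auto elim: eventually_mono)
  qed
qed

text \<open>Karamata's argument: \<open>q(exp (-t)) exp (-t)\<close> lies in the subspace for polynomials \<open>q\<close>, hence
  for continuous \<open>q\<close>, hence for \<open>q(u) = 1/u\<close> cut off below \<open>u = exp (-1)\<close>.\<close>

lemma (in L1_subspace) indicator_mem:
  assumes E: "\<And>n::nat. n > 0 \<Longrightarrow> exp_kernel n \<in> K"
  shows "indicator {0..1} \<in> K"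
proof -
  have E1: "integrable lborel (exp_kernel 1)" "(\<integral>t. exp_kernel 1 t \<partial>lborel) = 1"
    using integrable_exp_kernel[of 1] integral_exp_kernel[of 1] by simp_all
  have [measurable]: "exp_kernel 1 \<in> borel_measurable lborel"
    using E1(1) by simp
  \<comment> \<open>The factor \<open>exp_kernel 1\<close> raises each exponent by one, so a
    constant term of \<open>p\<close> also yields an integrable kernel.\<close>
  have poly: "(\<lambda>t. exp_kernel 1 t * p (exp (- t))) \<in> K" if p: "real_polynomial_function p" for p
  proof -
    obtain a n where "p = (\<lambda>x. \<Sum>i\<le>n. a i * x ^ i)"
      using p real_polynomial_function_iff_sum by auto
    moreover have "exp_kernel (real (Suc i)) t = exp_kernel 1 t * exp (- t) ^ i" for i t
      by (simp add: exp_kernel_def algebra_simps exp_diff exp_minus power_inverse divide_inverse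
        flip: exp_of_nat_mult)
    ultimately have "exp_kernel 1 t * p (exp (- t)) = (\<Sum>i\<le>n. a i * exp_kernel (real (Suc i)) t)" for t
      by (simp add: sum_distrib_left mult_ac)
    then show ?thesis
      by (simp only:) (intro sum scale E, simp)
  qed
  have cont: "(\<lambda>t. exp_kernel 1 t * g (exp (- t))) \<in> K" if g: "continuous_on UNIV g" for g :: "real \<Rightarrow> real"
  proof (rule closed)
    have [measurable]: "g \<in> borel_measurable borel"
      using g by (rule borel_measurable_continuous_onI)
    have "compact (g ` {0..1})"
      using g by (intro compact_continuous_image) (auto intro: continuous_on_subset)
    then obtain B where B: "\<And>u. u \<in> {0..1} \<Longrightarrow> \<bar>g u\<bar> \<le> B"
      using compact_imp_bounded bounded_iff by (metis imageI real_norm_def)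
    show int: "integrable lborel (\<lambda>t. exp_kernel 1 t * g (exp (- t)))"
    proof (rule Bochner_Integration.integrable_bound[OF integrable_mult_left[OF E1(1), of B]])
      show "AE t in lborel. norm (exp_kernel 1 t * g (exp (- t))) \<le> norm (exp_kernel 1 t * B)"
        using B[THEN order_trans[OF _ abs_ge_self]]
        by (intro AE_I2) (auto simp: exp_kernel_def indicator_def abs_mult)
    qed measurable
    fix e :: real assume "e > 0"
    \<comment> \<open>The interval [0, 1] suffices because the kernel lives on
      \<open>t \<ge> 0\<close>; it has total mass 1, so a uniform error \<open>e / 2\<close> stays
      an L1 error of at most \<open>e / 2\<close>.\<close>
    obtain p where p: "real_polynomial_function p" "\<And>u. u \<in> {0..1} \<Longrightarrow> \<bar>g u - p u\<bar> < e / 2"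
      using Stone_Weierstrass_real_polynomial_function[of "{0..1}" g "e / 2"] g \<open>e > 0\<close>
      by (metis compact_Icc continuous_on_subset half_gt_zero subset_UNIV)
    have "(\<integral>t. \<bar>exp_kernel 1 t * g (exp (- t)) - exp_kernel 1 t * p (exp (- t))\<bar> \<partial>lborel)
        \<le> (\<integral>t. exp_kernel 1 t * (e / 2) \<partial>lborel)"
    proof (rule integral_mono)
      show "\<bar>exp_kernel 1 t * g (exp (- t)) - exp_kernel 1 t * p (exp (- t))\<bar> \<le> exp_kernel 1 t * (e / 2)" for t
        using p(2)[of "exp (- t)"]
        by (auto simp: exp_kernel_def indicator_def abs_mult simp flip: right_diff_distrib)
    qed (use E1(1) int integrable[OF poly[OF p(1)]] in auto)
    also have "\<dots> < e"
      using E1 \<open>e > 0\<close> by simp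
    finally show "\<exists>h\<in>K. (\<integral>t. \<bar>exp_kernel 1 t * g (exp (- t)) - h t\<bar> \<partial>lborel) < e"
      using poly[OF p(1)] by (auto intro!: bexI[rotated])
  qed
  define c :: real where "c = exp (- 1)"
  \<comment> \<open>The numerator is a continuous ramp: for positive \<open>n\<close> it rises from
    0 at \<open>c - 1 / n\<close> to 1 at \<open>c\<close>, which corresponds to
    \<open>t = 1\<close>. The denominator is \<open>u\<close> above \<open>c\<close> and never drops
    below \<open>c\<close>, whence the bound \<open>1 / c\<close>.\<close>
  define g where "g = (\<lambda>n u::real. max 0 (min 1 (real n * (u - c) + 1)) / max u c)"
  have "c > 0"
    by (simp add: c_def)
  show ?thesis
  proof (rule dominated_limit)
    show "(\<lambda>t. exp_kernel 1 t * g n (exp (- t))) \<in> K" for n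
      unfolding g_def using \<open>c > 0\<close> by (intro cont continuous_intros) auto
    show "integrable lborel (\<lambda>t. exp_kernel 1 t * (1 / c))"
      using E1(1) by simp
    show "\<bar>exp_kernel 1 t * g n (exp (- t))\<bar> \<le> exp_kernel 1 t * (1 / c)" for n t
    proof -
      have "\<bar>g n (exp (- t))\<bar> \<le> 1 / c"
        unfolding g_def abs_divide using \<open>c > 0\<close> by (intro frac_le) auto
      then show ?thesis
        unfolding abs_mult abs_of_nonneg[OF exp_kernel_nonneg]
        by (rule mult_left_mono[OF _ exp_kernel_nonneg])
    qed
    have "(\<lambda>n. exp_kernel 1 t * g n (exp (- t))) \<longlonglongrightarrow> indicator {0..1} t" for t
    proof (cases "t \<le> 1")
      case True
      then have "exp (- t) \<ge> c"
        by (simp add: c_def)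
      then have "exp_kernel 1 t * g n (exp (- t)) = indicator {0..1} t" for n
        using True by (simp add: g_def exp_kernel_def indicator_def max_def min_def)
      then show ?thesis
        by simp
    next
      case False
      then have "exp (- t) < c"
        by (simp add: c_def)
      then have "\<forall>\<^sub>F n in sequentially. real n * (exp (- t) - c) + 1 \<le> 0"
        by real_asymp
      then have "\<forall>\<^sub>F n in sequentially. exp_kernel 1 t * g n (exp (- t)) = indicator {0..1} t"
        by eventually_elim (use False in \<open>simp add: g_def\<close>)
      then show ?thesis
        by (rule tendsto_eventually)
    qed
    then show "AE t in lborel. (\<lambda>n. exp_kernel 1 t * g n (exp (- t))) \<longlonglongrightarrow> indicator {0..1} t"
      by simp
  qed simp
qed

subsection \<open>Integrals along orbits\<close>

locale bicontinuous_contraction = bicontinuous_space \<tau> for \<tau> :: "'a::banach topology" +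
  fixes T :: "real \<Rightarrow> 'a \<Rightarrow>\<^sub>L 'a"
  assumes semigroup: "bicontinuous_semigroup \<tau> T"
    and contraction: "contraction_semigroup T"
begin

lemma T_0: "T 0 x = x"
  using semigroup by (simp add: bicontinuous_semigroup_def)

lemma T_add: "t \<ge> 0 \<Longrightarrow> s \<ge> 0 \<Longrightarrow> T (t + s) x = T t (T s x)"
  using semigroup by (simp add: bicontinuous_semigroup_def)

lemma norm_T_le: "t \<ge> 0 \<Longrightarrow> norm (T t x) \<le> norm x"
  using contraction norm_blinfun[of "T t" x] mult_right_mono[of "norm (T t)" 1 "norm x"]
  by (force simp: contraction_semigroup_def)

lemma continuous_map_orbit: "continuous_map (top_of_set {0..}) \<tau> (\<lambda>t. T t x)"
  using semigroup by (simp add: bicontinuous_semigroup_def)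

lemma limitin_T:
  assumes "bounded (range X)" "limitin \<tau> X y sequentially" "t \<ge> 0"
  shows "limitin \<tau> (\<lambda>n. T t (X n)) (T t y) sequentially"
  unfolding limitin_iff_nhds_0 eventually_sequentially
proof (intro allI impI)
  fix U assume "openin \<tau> U \<and> 0 \<in> U"
  then have "\<exists>N. \<forall>n\<ge>N. \<forall>s\<in>{0..t}. T s (X n) - T s y \<in> U"
    using semigroup assms unfolding bicontinuous_semigroup_def by meson
  then show "\<exists>N. \<forall>n\<ge>N. T t (X n) - T t y \<in> U"
    using assms(3) by force
qed

text \<open>Bi-continuity passes the \<tau>-limit through \<open>T h\<close>, and contractivity
  keeps the image sequence norm-bounded.\<close>

lemma seq_functional_T:
  assumes "seq_functional \<psi>" "h \<ge> 0"
  shows "seq_functional (\<lambda>x. \<psi> (T h x))"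
  unfolding seq_functional_def
proof (intro conjI allI impI)
  show "bounded_linear (\<lambda>x. \<psi> (T h x))"
    using seq_functional_bounded_linear[OF assms(1)] blinfun.bounded_linear_right
    by (rule bounded_linear_compose)
  fix X y assume X: "bounded (range X) \<and> limitin \<tau> X y sequentially"
  then obtain B where "\<And>n. norm (X n) \<le> B"
    by (auto simp: bounded_iff)
  then have "norm (T h (X n)) \<le> B" for n
    using norm_T_le[OF assms(2)] order_trans by blast
  then show "(\<lambda>n. \<psi> (T h (X n))) \<longlonglongrightarrow> \<psi> (T h y)"
    using X assms by (intro seq_functional_tendsto[OF assms(1)] limitin_T) auto
qed

text \<open>Orbits are extended constantly to negative times, so that kernels can be integrated against
  them over the whole line.\<close>

abbreviation orbit :: "('a \<Rightarrow> real) \<Rightarrow> 'a \<Rightarrow> real \<Rightarrow> real" where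
  "orbit \<psi> x t \<equiv> \<psi> (T (max 0 t) x)"

lemma abs_orbit_le:
  assumes "seq_functional \<psi>"
  shows "\<bar>orbit \<psi> x t\<bar> \<le> onorm \<psi> * norm x"
proof -
  note bl = seq_functional_bounded_linear[OF assms]
  have "\<bar>orbit \<psi> x t\<bar> \<le> onorm \<psi> * norm (T (max 0 t) x)"
    using onorm[OF bl] by simp
  also have "\<dots> \<le> onorm \<psi> * norm x"
    using onorm_pos_le[OF bl] norm_T_le by (intro mult_left_mono) auto
  finally show ?thesis .
qed

lemma continuous_on_orbit:
  assumes "seq_functional \<psi>"
  shows "continuous_on UNIV (orbit \<psi> x)"
proof -
  have "continuous_on {0..} (\<lambda>t. \<psi> (T t x))"
    using norm_T_le by (intro continuous_on_seq_functional[OF assms continuous_map_orbit]) auto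
  moreover have "continuous_on UNIV (\<lambda>t. max 0 t :: real)"
    by (intro continuous_intros)
  ultimately show ?thesis
    by (rule continuous_on_compose2) auto
qed

lemma borel_measurable_orbit [measurable]:
  assumes "seq_functional \<psi>"
  shows "orbit \<psi> x \<in> borel_measurable lborel"
  using borel_measurable_continuous_onI[OF continuous_on_orbit[OF assms]] by simp

lemma integrable_kernel_orbit:
  assumes k: "integrable lborel k" and \<psi>: "seq_functional \<psi>"
  shows "integrable lborel (\<lambda>t. k t * orbit \<psi> x t)"
proof (rule Bochner_Integration.integrable_bound)
  show "integrable lborel (\<lambda>t. k t * (onorm \<psi> * norm x))"
    using k by simp
  show "(\<lambda>t. k t * orbit \<psi> x t) \<in> borel_measurable lborel"
    using borel_measurable_integrable[OF k] borel_measurable_orbit[OF \<psi>] by (rule borel_measurable_times)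
  show "AE t in lborel. norm (k t * orbit \<psi> x t) \<le> norm (k t * (onorm \<psi> * norm x))"
    using abs_orbit_le[OF \<psi>, THEN order_trans[OF _ abs_ge_self]]
    by (intro AE_I2) (simp only: real_norm_def abs_mult mult_left_mono abs_ge_zero)
qed

lemma abs_integral_kernel_orbit_le:
  assumes k: "integrable lborel k" and \<psi>: "seq_functional \<psi>"
  shows "\<bar>\<integral>t. k t * orbit \<psi> x t \<partial>lborel\<bar> \<le> (\<integral>t. \<bar>k t\<bar> \<partial>lborel) * (onorm \<psi> * norm x)"
proof -
  have "\<bar>\<integral>t. k t * orbit \<psi> x t \<partial>lborel\<bar> \<le> (\<integral>t. \<bar>k t * orbit \<psi> x t\<bar> \<partial>lborel)"
    by (rule integral_abs_bound)
  also have "\<dots> \<le> (\<integral>t. \<bar>k t\<bar> * (onorm \<psi> * norm x) \<partial>lborel)"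
  proof (rule integral_mono)
    show "\<bar>k t * orbit \<psi> x t\<bar> \<le> \<bar>k t\<bar> * (onorm \<psi> * norm x)" for t
      unfolding abs_mult by (rule mult_left_mono[OF abs_orbit_le[OF \<psi>] abs_ge_zero])
  qed (use integrable_kernel_orbit[OF k \<psi>, of x] k in \<open>auto intro: integrable_abs\<close>)
  finally show ?thesis
    by simp
qed

text \<open>Testing against all of \<^const>\<open>seq_functional\<close>, and not just the dual, makes the notion
  stable under \<open>T(h)\<close>.\<close>

definition orbit_integral :: "(real \<Rightarrow> real) \<Rightarrow> 'a \<Rightarrow> 'a \<Rightarrow> bool" where
  "orbit_integral k x v \<longleftrightarrow>
    (\<forall>\<psi>. seq_functional \<psi> \<longrightarrow> \<psi> v = (\<integral>t. k t * orbit \<psi> x t \<partial>lborel))"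

lemma orbit_integralD:
  "orbit_integral k x v \<Longrightarrow> seq_functional \<psi> \<Longrightarrow> \<psi> v = (\<integral>t. k t * orbit \<psi> x t \<partial>lborel)"
  by (simp add: orbit_integral_def)

lemma orbit_integral_zero: "orbit_integral (\<lambda>_. 0) x 0"
  by (simp add: orbit_integral_def bounded_linear.linear linear_0 seq_functional_bounded_linear)

lemma orbit_integral_add:
  assumes "integrable lborel k" "integrable lborel l" "orbit_integral k x v" "orbit_integral l x w"
  shows "orbit_integral (\<lambda>t. k t + l t) x (v + w)"
  using assms integrable_kernel_orbit unfolding orbit_integral_def
  by (simp add: distrib_right linear_add bounded_linear.linear seq_functional_bounded_linear)

lemma orbit_integral_scale:
  assumes "orbit_integral k x v"
  shows "orbit_integral (\<lambda>t. c * k t) x (c *\<^sub>R v)"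
  using assms unfolding orbit_integral_def
  by (simp add: mult.assoc linear_scale bounded_linear.linear seq_functional_bounded_linear)

lemma orbit_integral_diff:
  assumes "integrable lborel k" "integrable lborel l" "orbit_integral k x v" "orbit_integral l x w"
  shows "orbit_integral (\<lambda>t. k t - l t) x (v - w)"
  using orbit_integral_add[OF assms(1) integrable_mult_right[OF assms(2)] assms(3)
      orbit_integral_scale[OF assms(4)], of "- 1"] by simp

text \<open>The scalar estimate holds for each dual functional of norm at most one, and these norm
  the space. This is the bridge from L1 convergence of kernels to norm convergence of
  vectors.\<close>

lemma norm_orbit_integral_le:
  assumes k: "integrable lborel k" and v: "orbit_integral k x v"
  shows "norm v \<le> (\<integral>t. \<bar>k t\<bar> \<partial>lborel) * norm x"
proof (rule norm_le_dual)
  fix \<phi> assume "\<phi> \<in> topological_dual \<tau>" and le: "onorm \<phi> \<le> 1"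
  then have \<phi>: "seq_functional \<phi>"
    by (simp add: dual_seq_functional)
  then have "\<bar>\<phi> v\<bar> \<le> (\<integral>t. \<bar>k t\<bar> \<partial>lborel) * (onorm \<phi> * norm x)"
    unfolding orbit_integralD[OF v \<phi>] by (intro abs_integral_kernel_orbit_le[OF k])
  also have "\<dots> \<le> (\<integral>t. \<bar>k t\<bar> \<partial>lborel) * (1 * norm x)"
    using le by (intro mult_left_mono mult_right_mono) auto
  finally show "\<bar>\<phi> v\<bar> \<le> (\<integral>t. \<bar>k t\<bar> \<partial>lborel) * norm x"
    by simp
qed

lemma norm_orbit_integral_diff_le:
  assumes "integrable lborel k" "integrable lborel l" "orbit_integral k x v" "orbit_integral l x w"
  shows "norm (v - w) \<le> (\<integral>t. \<bar>k t - l t\<bar> \<partial>lborel) * norm x"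
  using assms by (intro norm_orbit_integral_le orbit_integral_diff) auto

lemma orbit_integral_unique:
  assumes "orbit_integral k x v" "orbit_integral k x w"
  shows "v = w"
proof (rule eq_if_dual_eq)
  fix \<phi> assume "\<phi> \<in> topological_dual \<tau>"
  then have "seq_functional \<phi>"
    by (rule dual_seq_functional)
  then show "\<phi> v = \<phi> w"
    using assms[THEN orbit_integralD] by metis
qed

lemma orbit_integral_indicator:
  assumes "r > 0"
  shows "has_Riemann_integral_in \<tau> (\<lambda>s. T s x) (Riemann_integral_in \<tau> 0 r (\<lambda>s. T s x)) 0 r"
    and "orbit_integral (indicator {0..r}) x (Riemann_integral_in \<tau> 0 r (\<lambda>s. T s x))"
proof -
  have cont: "continuous_map (top_of_set {0..r}) \<tau> (\<lambda>t. T t x)"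
    using continuous_map_orbit by (rule continuous_map_from_subtopology_mono) auto
  have oi: "orbit_integral (indicator {0..r}) x v"
    if "has_Riemann_integral_in \<tau> (\<lambda>s. T s x) v 0 r" for v
    unfolding orbit_integral_def
  proof (intro allI impI)
    fix \<psi> assume \<psi>: "seq_functional \<psi>"
    have "((\<lambda>s. \<psi> (T s x)) has_integral \<psi> v) {0..r}"
      using that cont norm_T_le \<psi> \<open>r > 0\<close> by (intro has_integral_seq_functional) auto
    then have "(orbit \<psi> x has_integral \<psi> v) {0..r}"
      by (rule has_integral_eq[rotated]) simp
    moreover have "set_integrable lborel {0..r} (orbit \<psi> x)"
      using continuous_on_orbit[OF \<psi>] by (intro borel_integrable_atLeastAtMost') (auto intro: continuous_on_subset)
    ultimately show "\<psi> v = (\<integral>t. indicator {0..r} t * orbit \<psi> x t \<partial>lborel)"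
      using set_borel_integral_eq_integral(2)[of "{0..r}" "orbit \<psi> x"]
      by (simp add: set_lebesgue_integral_def integral_unique)
  qed
  obtain v where "has_Riemann_integral_in \<tau> (\<lambda>s. T s x) v 0 r"
    using norm_T_le by (rule Riemann_integrable_in[OF \<open>r > 0\<close> cont, of "norm x"]) auto
  \<comment> \<open>The definite description needs uniqueness: two Riemann integrals are both weak
    integrals of the same kernel, hence equal.\<close>
  then have "has_Riemann_integral_in \<tau> (\<lambda>s. T s x) (Riemann_integral_in \<tau> 0 r (\<lambda>s. T s x)) 0 r"
    unfolding Riemann_integral_in_def by (rule theI) (blast intro: orbit_integral_unique oi \<open>has_Riemann_integral_in \<tau> (\<lambda>s. T s x) v 0 r\<close>)
  then show "has_Riemann_integral_in \<tau> (\<lambda>s. T s x) (Riemann_integral_in \<tau> 0 r (\<lambda>s. T s x)) 0 r"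
    and "orbit_integral (indicator {0..r}) x (Riemann_integral_in \<tau> 0 r (\<lambda>s. T s x))"
    using oi by auto
qed

text \<open>For closedness, the vectors belonging to an L1-convergent sequence of kernels are
  norm-Cauchy; their limit in the Banach space is the integral of the limit kernel.\<close>

lemma L1_subspace_orbit_integral: "L1_subspace {k. integrable lborel k \<and> (\<exists>v. orbit_integral k x v)}"
proof
  fix f :: "real \<Rightarrow> real" assume f: "integrable lborel f"
    and approx: "\<And>e. e > 0 \<Longrightarrow> \<exists>g\<in>{k. integrable lborel k \<and> (\<exists>v. orbit_integral k x v)}.
      (\<integral>t. \<bar>f t - g t\<bar> \<partial>lborel) < e"
  have "\<exists>g v. integrable lborel g \<and> orbit_integral g x v \<and>
      (\<integral>t. \<bar>f t - g t\<bar> \<partial>lborel) < inverse (real (Suc n))" for n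
    using approx[of "inverse (real (Suc n))"] by auto
  then obtain g v where g: "\<And>n. integrable lborel (g n)" and v: "\<And>n. orbit_integral (g n) x (v n)"
    and fg: "\<And>n. (\<integral>t. \<bar>f t - g n t\<bar> \<partial>lborel) < inverse (real (Suc n))"
    by metis
  have lim0: "(\<lambda>n. \<integral>t. \<bar>f t - g n t\<bar> \<partial>lborel) \<longlonglongrightarrow> 0"
    using fg by (intro Lim_null_comparison[OF _ LIMSEQ_inverse_real_of_nat])
      (auto intro!: always_eventually less_imp_le)
  have dist: "norm (v m - v n) \<le> ((\<integral>t. \<bar>f t - g m t\<bar> \<partial>lborel) + (\<integral>t. \<bar>f t - g n t\<bar> \<partial>lborel)) * norm x" for m n
  proof -
    have "(\<integral>t. \<bar>g m t - g n t\<bar> \<partial>lborel) \<le> (\<integral>t. \<bar>f t - g m t\<bar> + \<bar>f t - g n t\<bar> \<partial>lborel)"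
      using f g by (intro integral_mono) auto
    also have "\<dots> = (\<integral>t. \<bar>f t - g m t\<bar> \<partial>lborel) + (\<integral>t. \<bar>f t - g n t\<bar> \<partial>lborel)"
      using f g by (intro Bochner_Integration.integral_add) auto
    finally show ?thesis
      by (intro order_trans[OF norm_orbit_integral_diff_le[OF g g v v] mult_right_mono]) auto
  qed
  have "Cauchy v"
    unfolding Cauchy_iff
  proof (intro allI impI)
    fix e :: real assume "e > 0"
    \<comment> \<open>Adding 1 covers the case \<open>x = 0\<close>.\<close>
    define d where "d = e / (2 * (norm x + 1))"
    have "d > 0"
      using \<open>e > 0\<close> by (simp add: d_def add_nonneg_pos)
    from order_tendstoD(2)[OF lim0 this] obtain N where N: "\<And>n. n \<ge> N \<Longrightarrow> (\<integral>t. \<bar>f t - g n t\<bar> \<partial>lborel) < d"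
      by (auto simp: eventually_sequentially)
    have "norm (v m - v n) < e" if "m \<ge> N" "n \<ge> N" for m n
    proof -
      have "norm (v m - v n) \<le> (d + d) * norm x"
        using N[OF that(1)] N[OF that(2)] by (intro order_trans[OF dist] mult_right_mono) auto
      also have "\<dots> < (d + d) * (norm x + 1)"
        using \<open>d > 0\<close> by (intro mult_strict_left_mono) auto
      also have "\<dots> = e"
        by (simp add: d_def field_simps add_nonneg_eq_0_iff)
      finally show ?thesis .
    qed
    then show "\<exists>M. \<forall>m\<ge>M. \<forall>n\<ge>M. norm (v m - v n) < e"
      by blast
  qed
  then obtain w where w: "v \<longlonglongrightarrow> w"
    using Cauchy_convergent convergent_def by metis
  have "orbit_integral f x w"
    unfolding orbit_integral_def
  proof (intro allI impI)
    fix \<psi> assume \<psi>: "seq_functional \<psi>"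
    have lim1: "(\<lambda>n. \<psi> (v n)) \<longlonglongrightarrow> \<psi> w"
      using w by (rule bounded_linear.tendsto[OF seq_functional_bounded_linear[OF \<psi>]])
    have "norm (\<psi> (v n) - (\<integral>t. f t * orbit \<psi> x t \<partial>lborel))
        \<le> (\<integral>t. \<bar>f t - g n t\<bar> \<partial>lborel) * (onorm \<psi> * norm x)" for n
    proof -
      have "(\<integral>t. f t * orbit \<psi> x t \<partial>lborel) - \<psi> (v n) = (\<integral>t. (f t - g n t) * orbit \<psi> x t \<partial>lborel)"
        unfolding orbit_integralD[OF v \<psi>] left_diff_distrib
        using integrable_kernel_orbit[OF f \<psi>, of x] integrable_kernel_orbit[OF g[of n] \<psi>, of x]
        by simp
      then show ?thesis
        using abs_integral_kernel_orbit_le[OF _ \<psi>, of "\<lambda>t. f t - g n t" x] f g[of n]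
        by (simp add: abs_minus_commute)
    qed
    moreover have "(\<lambda>n. (\<integral>t. \<bar>f t - g n t\<bar> \<partial>lborel) * (onorm \<psi> * norm x)) \<longlonglongrightarrow> 0"
      using lim0 by (rule tendsto_mult_left_zero)
    ultimately have "(\<lambda>n. \<psi> (v n) - (\<integral>t. f t * orbit \<psi> x t \<partial>lborel)) \<longlonglongrightarrow> 0"
      by (rule Lim_null_comparison[OF always_eventually[OF allI]])
    from LIMSEQ_unique[OF lim1 LIM_zero_cancel[OF this]]
    show "\<psi> w = (\<integral>t. f t * orbit \<psi> x t \<partial>lborel)" .
  qed
  with f show "f \<in> {k. integrable lborel k \<and> (\<exists>v. orbit_integral k x v)}"
    by blast
qed (auto intro: orbit_integral_zero, (rule exI, erule (3) orbit_integral_add), rule exI, erule orbit_integral_scale)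

lemma ex_orbit_integral_exp_kernel:
  assumes "\<mu> > 0"
  shows "\<exists>v. orbit_integral (exp_kernel \<mu>) x v"
proof -
  interpret L1_subspace "{k. integrable lborel k \<and> (\<exists>v. orbit_integral k x v)}"
    by (rule L1_subspace_orbit_integral)
  have "exp_kernel \<mu> \<in> {k. integrable lborel k \<and> (\<exists>v. orbit_integral k x v)}"
    using assms orbit_integral_indicator(2) by (intro exp_kernel_mem) auto
  then show ?thesis
    by simp
qed

end

subsection \<open>Rescaled kernels\<close>

lemma limitin_compose_filterlim:
  "limitin X f l G \<Longrightarrow> filterlim g G F \<Longrightarrow> limitin X (\<lambda>t. f (g t)) l F"
  by (auto simp: limitin_def filterlim_iff)

text \<open>For positive \<open>l\<close> the dilation preserves mass and L1 norm, and for small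
  \<open>l\<close> it spreads the kernel over times of order \<open>1 / l\<close>. It turns the
  indicator of [0, 1] into the Cesaro mean at \<open>1 / l\<close> and \<open>exp_kernel 1\<close>
  into \<open>l * exp_kernel l\<close>.\<close>

definition rescale :: "real \<Rightarrow> (real \<Rightarrow> real) \<Rightarrow> real \<Rightarrow> real" where
  "rescale l k t = l * k (l * t)"

lemma integrable_rescale: "l > 0 \<Longrightarrow> integrable lborel k \<Longrightarrow> integrable lborel (rescale l k)"
  unfolding rescale_def using lborel_integrable_real_affine[of k l 0] by simp

lemma integral_rescale: "l > 0 \<Longrightarrow> (\<integral>t. rescale l k t \<partial>lborel) = (\<integral>t. k t \<partial>lborel)"
  unfolding rescale_def using lborel_integral_real_affine[of l k 0] by simp

lemma integral_abs_rescale_diff: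
  "l > 0 \<Longrightarrow> (\<integral>t. \<bar>rescale l k t - rescale l h t\<bar> \<partial>lborel) = (\<integral>t. \<bar>k t - h t\<bar> \<partial>lborel)"
  using integral_rescale[of l "\<lambda>t. \<bar>k t - h t\<bar>"]
  by (simp add: rescale_def abs_mult flip: right_diff_distrib)

context bicontinuous_contraction
begin

text \<open>The weak integral is a relation, so its values are collected in a family
  \<open>V\<close>; for positive \<open>l\<close> uniqueness determines it.\<close>

definition rescaled_limit :: "'a \<Rightarrow> 'a \<Rightarrow> (real \<Rightarrow> real) \<Rightarrow> bool" where
  "rescaled_limit x y k \<longleftrightarrow> integrable lborel k \<and>
    (\<exists>V. (\<forall>l>0. orbit_integral (rescale l k) x (V l)) \<and>
         limitin \<tau> V ((\<integral>t. k t \<partial>lborel) *\<^sub>R y) (at_right 0))"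

lemma rescaled_limit_iff:
  assumes k: "integrable lborel k" and V: "\<And>l. l > 0 \<Longrightarrow> orbit_integral (rescale l k) x (V l)"
  shows "rescaled_limit x y k \<longleftrightarrow> limitin \<tau> V ((\<integral>t. k t \<partial>lborel) *\<^sub>R y) (at_right 0)"
proof
  assume "rescaled_limit x y k"
  then obtain W where W: "\<And>l. l > 0 \<Longrightarrow> orbit_integral (rescale l k) x (W l)"
    "limitin \<tau> W ((\<integral>t. k t \<partial>lborel) *\<^sub>R y) (at_right 0)"
    unfolding rescaled_limit_def by auto
  have "\<forall>\<^sub>F l in at_right 0. W l = V l"
    using orbit_integral_unique[OF W(1) V] by (auto simp: eventually_at_filter)
  then show "limitin \<tau> V ((\<integral>t. k t \<partial>lborel) *\<^sub>R y) (at_right 0)"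
    using W(2) by (rule limitin_transform_eventually)
qed (use k V in \<open>auto simp: rescaled_limit_def\<close>)

lemma rescaled_limit_zero: "rescaled_limit x y (\<lambda>_. 0)"
  using orbit_integral_zero by (subst rescaled_limit_iff[of _ _ "\<lambda>_. 0"]) (auto simp: rescale_def[abs_def])

lemma rescaled_limit_add:
  assumes "rescaled_limit x y k" "rescaled_limit x y h"
  shows "rescaled_limit x y (\<lambda>t. k t + h t)"
proof -
  obtain V W where k: "integrable lborel k" and V: "\<And>l. l > 0 \<Longrightarrow> orbit_integral (rescale l k) x (V l)"
      "limitin \<tau> V ((\<integral>t. k t \<partial>lborel) *\<^sub>R y) (at_right 0)"
    and h: "integrable lborel h" and W: "\<And>l. l > 0 \<Longrightarrow> orbit_integral (rescale l h) x (W l)"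
      "limitin \<tau> W ((\<integral>t. h t \<partial>lborel) *\<^sub>R y) (at_right 0)"
    using assms unfolding rescaled_limit_def by auto
  have "orbit_integral (rescale l (\<lambda>t. k t + h t)) x (V l + W l)" if "l > 0" for l
    using orbit_integral_add[OF integrable_rescale[OF that k] integrable_rescale[OF that h] V(1) W(1)] that
    by (simp add: rescale_def[abs_def] distrib_left)
  then show ?thesis
    using limitin_add[OF V(2) W(2)] k h
    by (subst rescaled_limit_iff[of _ _ "\<lambda>l. V l + W l"]) (auto simp: scaleR_add_left)
qed

lemma rescaled_limit_scale:
  assumes "rescaled_limit x y k"
  shows "rescaled_limit x y (\<lambda>t. c * k t)"
proof -
  obtain V where k: "integrable lborel k" and V: "\<And>l. l > 0 \<Longrightarrow> orbit_integral (rescale l k) x (V l)"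
      "limitin \<tau> V ((\<integral>t. k t \<partial>lborel) *\<^sub>R y) (at_right 0)"
    using assms unfolding rescaled_limit_def by auto
  have "orbit_integral (rescale l (\<lambda>t. c * k t)) x (c *\<^sub>R V l)" if "l > 0" for l
    using orbit_integral_scale[OF V(1)[OF that], of c] by (simp add: rescale_def[abs_def] mult.left_commute)
  then show ?thesis
    using limitin_scaleR[OF tendsto_const V(2), of c] k
    by (subst rescaled_limit_iff[of _ _ "\<lambda>l. c *\<^sub>R V l"]) auto
qed

text \<open>Rescaling the dilated kernel by \<open>l\<close> is \<open>1 / r\<close> times rescaling
  \<open>k\<close> by \<open>r * l\<close>, and \<open>r * l\<close> tends to 0 from the right
  together with \<open>l\<close>.\<close>

lemma rescaled_limit_dilate:
  assumes "rescaled_limit x y k" "r > 0"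
  shows "rescaled_limit x y (\<lambda>t. k (r * t))"
proof -
  obtain V where k: "integrable lborel k" and V: "\<And>l. l > 0 \<Longrightarrow> orbit_integral (rescale l k) x (V l)"
      "limitin \<tau> V ((\<integral>t. k t \<partial>lborel) *\<^sub>R y) (at_right 0)"
    using assms unfolding rescaled_limit_def by auto
  have "orbit_integral (rescale l (\<lambda>t. k (r * t))) x ((1 / r) *\<^sub>R V (r * l))" if "l > 0" for l
    using orbit_integral_scale[OF V(1)[of "r * l"], of "1 / r"] that \<open>r > 0\<close>
    by (simp add: rescale_def[abs_def] mult_ac)
  moreover have "filterlim (\<lambda>l. r * l) (at_right 0) (at_right 0)"
    using \<open>r > 0\<close> by real_asymp
  from limitin_scaleR[OF tendsto_const limitin_compose_filterlim[OF V(2) this], of "1 / r"]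
  have "limitin \<tau> (\<lambda>l. (1 / r) *\<^sub>R V (r * l)) (((1 / r) * (\<integral>t. k t \<partial>lborel)) *\<^sub>R y) (at_right 0)"
    by simp
  moreover have "(\<integral>t. k (r * t) \<partial>lborel) = (1 / r) * (\<integral>t. k t \<partial>lborel)"
    using integral_rescale[OF \<open>r > 0\<close>, of k] \<open>r > 0\<close> by (simp add: rescale_def field_simps)
  moreover have "integrable lborel (\<lambda>t. k (r * t))"
    using lborel_integrable_real_affine[OF k, of r 0] \<open>r > 0\<close> by simp
  ultimately show ?thesis
    by (subst rescaled_limit_iff[of _ _ "\<lambda>l. (1 / r) *\<^sub>R V (r * l)"]) auto
qed

text \<open>A three-term estimate: replacing \<open>f\<close> by \<open>g\<close> costs at most the
  L1 distance times the norm of \<open>x\<close> for every \<open>l\<close> at once, and times the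
  norm of \<open>y\<close> in the limit; the middle term converges by the choice of
  \<open>g\<close>.\<close>

lemma rescaled_limit_closed:
  assumes f: "integrable lborel f"
    and approx: "\<And>e. e > 0 \<Longrightarrow> \<exists>g. rescaled_limit x y g \<and> (\<integral>t. \<bar>f t - g t\<bar> \<partial>lborel) < e"
  shows "rescaled_limit x y f"
proof -
  interpret E: L1_subspace "{k. integrable lborel k \<and> (\<exists>v. orbit_integral k x v)}"
    by (rule L1_subspace_orbit_integral)
  have "\<exists>v. orbit_integral (rescale l f) x v" if "l > 0" for l
  proof -
    have "rescale l f \<in> {k. integrable lborel k \<and> (\<exists>v. orbit_integral k x v)}"
    proof (rule E.closed)
      fix e :: real assume "e > 0"
      then obtain g where g: "rescaled_limit x y g" "(\<integral>t. \<bar>f t - g t\<bar> \<partial>lborel) < e"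
        using approx by blast
      then have "rescale l g \<in> {k. integrable lborel k \<and> (\<exists>v. orbit_integral k x v)}"
        using that integrable_rescale unfolding rescaled_limit_def by blast
      moreover have "(\<integral>t. \<bar>rescale l f t - rescale l g t\<bar> \<partial>lborel) < e"
        using g(2) that by (simp add: integral_abs_rescale_diff)
      ultimately show "\<exists>g\<in>{k. integrable lborel k \<and> (\<exists>v. orbit_integral k x v)}.
          (\<integral>t. \<bar>rescale l f t - g t\<bar> \<partial>lborel) < e"
        by blast
    qed (rule integrable_rescale[OF that f])
    then show ?thesis
      by simp
  qed
  then obtain V where V: "\<And>l. l > 0 \<Longrightarrow> orbit_integral (rescale l f) x (V l)"
    by metis
  have "limitin \<tau> V ((\<integral>t. f t \<partial>lborel) *\<^sub>R y) (at_right 0)"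
    unfolding limitin_iff_nhds_0
  proof (intro allI impI)
    fix U assume "openin \<tau> U \<and> 0 \<in> U"
    then obtain N where N: "openin \<tau> N" "0 \<in> N" "\<And>u v. u \<in> N \<Longrightarrow> v \<in> N \<Longrightarrow> u + v \<in> U"
      using convex_nhd_0_half by metis
    \<comment> \<open>Coarseness of \<open>\<tau>\<close> puts a norm ball inside \<open>N\<close>,
      so that the two errors measured in norm can be absorbed.\<close>
    have "open N"
      using setting N(1) by (simp add: bicontinuous_setting_def)
    with N(2) obtain e where e: "e > 0" "\<And>u. norm u < e \<Longrightarrow> u \<in> N"
      by (metis open_contains_ball dist_0_norm mem_ball subsetD)
    \<comment> \<open>Chosen so that \<open>d * norm x + d * norm y\<close> stays strictly below
      \<open>e\<close>.\<close>
    define d where "d = e / (norm x + norm y + 1)"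
    have pos: "norm x + norm y + 1 > 0"
      by (simp add: add_nonneg_pos)
    with e(1) have "d > 0"
      by (simp add: d_def)
    then obtain g where g: "rescaled_limit x y g" and fg: "(\<integral>t. \<bar>f t - g t\<bar> \<partial>lborel) < d"
      using approx by blast
    obtain W where W: "\<And>l. l > 0 \<Longrightarrow> orbit_integral (rescale l g) x (W l)"
      and lim: "limitin \<tau> W ((\<integral>t. g t \<partial>lborel) *\<^sub>R y) (at_right 0)" and gi: "integrable lborel g"
      using g unfolding rescaled_limit_def by auto
    have ev: "\<forall>\<^sub>F l in at_right 0. W l - (\<integral>t. g t \<partial>lborel) *\<^sub>R y \<in> N"
      using lim N(1,2) unfolding limitin_iff_nhds_0 by blast
    have "\<forall>\<^sub>F l in at_right (0::real). l > 0"
      by (rule eventually_at_right_less)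
    with ev show "\<forall>\<^sub>F l in at_right 0. V l - (\<integral>t. f t \<partial>lborel) *\<^sub>R y \<in> U"
    proof eventually_elim
      case (elim l)
      have "norm (V l - W l) \<le> (\<integral>t. \<bar>rescale l f t - rescale l g t\<bar> \<partial>lborel) * norm x"
        by (intro norm_orbit_integral_diff_le integrable_rescale V W elim f gi)
      also have "\<dots> \<le> d * norm x"
        using fg elim by (intro mult_right_mono) (simp_all add: integral_abs_rescale_diff)
      finally have "norm (V l - W l) \<le> d * norm x" .
      moreover have "norm (((\<integral>t. f t \<partial>lborel) - (\<integral>t. g t \<partial>lborel)) *\<^sub>R y) \<le> d * norm y"
      proof -
        have "\<bar>(\<integral>t. f t \<partial>lborel) - (\<integral>t. g t \<partial>lborel)\<bar> \<le> d"
          using integral_abs_bound[of lborel "\<lambda>t. f t - g t"] f gi fg by simp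
        then show ?thesis
          by (simp add: mult_right_mono)
      qed
      ultimately have "norm ((V l - W l) - ((\<integral>t. f t \<partial>lborel) - (\<integral>t. g t \<partial>lborel)) *\<^sub>R y)
          \<le> d * norm x + d * norm y"
        using norm_triangle_ineq4 order_trans add_mono by meson
      also have "\<dots> < d * (norm x + norm y + 1)"
        using \<open>d > 0\<close> by (simp add: distrib_left)
      also have "\<dots> = e"
        using pos by (simp add: d_def)
      finally have "((V l - W l) - ((\<integral>t. f t \<partial>lborel) - (\<integral>t. g t \<partial>lborel)) *\<^sub>R y)
          + (W l - (\<integral>t. g t \<partial>lborel) *\<^sub>R y) \<in> U"
        using elim e(2) N(3) by blast
      then show ?case
        by (simp add: algebra_simps)
    qed
  qed
  then show ?thesis
    using rescaled_limit_iff[OF f V] by blast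
qed

lemma L1_subspace_rescaled_limit: "L1_subspace {k. rescaled_limit x y k}"
  using rescaled_limit_closed
  by unfold_locales
    (auto simp: rescaled_limit_zero rescaled_limit_add rescaled_limit_scale, simp add: rescaled_limit_def)

lemma rescaled_limit_exp_kernel_iff:
  "rescaled_limit x y (exp_kernel 1) \<longleftrightarrow> rescaled_limit x y (indicator {0..1})"
proof -
  interpret L1_subspace "{k. rescaled_limit x y k}"
    by (rule L1_subspace_rescaled_limit)
  show ?thesis
  proof
    assume lim: "rescaled_limit x y (exp_kernel 1)"
    \<comment> \<open>A limit assumed for one exponential passes by dilation to all integer rates,
      as Karamata's argument requires; in the converse direction, to indicators of all
      lengths.\<close>
    have "(\<lambda>t. exp_kernel 1 (real n * t)) = exp_kernel (real n)" if "n > 0" for n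
      using that by (auto simp: exp_kernel_def indicator_def zero_le_mult_iff)
    then have "indicator {0..1} \<in> {k. rescaled_limit x y k}"
      using rescaled_limit_dilate[OF lim] by (intro indicator_mem) (metis mem_Collect_eq of_nat_0_less_iff)
    then show "rescaled_limit x y (indicator {0..1})"
      by simp
  next
    assume lim: "rescaled_limit x y (indicator {0..1})"
    have "(\<lambda>t. indicator {0..1} (1 / r * t)) = (indicator {0..r} :: real \<Rightarrow> real)" if "r > 0" for r
      using that by (auto simp: indicator_def field_simps zero_le_mult_iff)
    then have "indicator {0..r} \<in> {k. rescaled_limit x y k}" if "r > 0" for r
      using rescaled_limit_dilate[OF lim, of "1 / r"] that by simp
    then have "exp_kernel 1 \<in> {k. rescaled_limit x y k}"
      by (intro exp_kernel_mem) auto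
    then show "rescaled_limit x y (exp_kernel 1)"
      by simp
  qed
qed

section \<open>Cesaro means as integrals against rescaled indicators\<close>

lemma orbit_integral_Cesaro_mean:
  assumes "l > 0"
  shows "orbit_integral (rescale l (indicator {0..1})) x (Cesaro_mean \<tau> T (1 / l) x)"
proof -
  have "rescale l (indicator {0..1}) = (\<lambda>t. l * indicator {0..1 / l} t)"
    using assms by (auto simp: rescale_def indicator_def field_simps zero_le_mult_iff)
  then show ?thesis
    using orbit_integral_scale[OF orbit_integral_indicator(2)[of "1 / l" x], of l] assms
    by (simp add: Cesaro_mean_def)
qed

lemma rescaled_limit_indicator_iff:
  "rescaled_limit x y (indicator {0..1}) \<longleftrightarrow> limitin \<tau> (\<lambda>r. Cesaro_mean \<tau> T r x) y at_top"
proof -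
  have "rescaled_limit x y (indicator {0..1}) \<longleftrightarrow>
      limitin \<tau> (\<lambda>l. Cesaro_mean \<tau> T (1 / l) x) y (at_right 0)"
    using orbit_integral_Cesaro_mean by (subst rescaled_limit_iff) auto
  also have "\<dots> \<longleftrightarrow> limitin \<tau> (\<lambda>r. Cesaro_mean \<tau> T r x) y at_top"
  proof
    assume "limitin \<tau> (\<lambda>l. Cesaro_mean \<tau> T (1 / l) x) y (at_right 0)"
    moreover have "filterlim (\<lambda>r::real. 1 / r) (at_right 0) at_top"
      by real_asymp
    ultimately have "limitin \<tau> (\<lambda>r. Cesaro_mean \<tau> T (1 / (1 / r)) x) y at_top"
      by (rule limitin_compose_filterlim)
    then show "limitin \<tau> (\<lambda>r. Cesaro_mean \<tau> T r x) y at_top"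
      by simp
  next
    assume "limitin \<tau> (\<lambda>r. Cesaro_mean \<tau> T r x) y at_top"
    moreover have "filterlim (\<lambda>r::real. 1 / r) at_top (at_right 0)"
      by real_asymp
    ultimately show "limitin \<tau> (\<lambda>l. Cesaro_mean \<tau> T (1 / l) x) y (at_right 0)"
      by (rule limitin_compose_filterlim)
  qed
  finally show ?thesis .
qed

subsection \<open>The resolvent as a Laplace transform\<close>

text \<open>Averages of \<open>T s x - x\<close> over short times stay in a convex neighbourhood.
  This is applied to tagged sums; as the neighbourhood need not be closed, the passage to the
  integral costs a second copy of \<open>V\<close>.\<close>

lemma limitin_Cesaro_mean_0: "limitin \<tau> (\<lambda>h. Cesaro_mean \<tau> T h x) x (at_right 0)"
  unfolding limitin_iff_nhds_0
proof (intro allI impI)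
  fix U assume "openin \<tau> U \<and> 0 \<in> U"
  then obtain V where V: "openin \<tau> V" "0 \<in> V" "convex V" "\<And>u v. u \<in> V \<Longrightarrow> v \<in> V \<Longrightarrow> u + v \<in> U"
    using convex_nhd_0_half by metis
  have "continuous_map (top_of_set {0..1}) \<tau> (\<lambda>t. T t x)"
    using continuous_map_orbit by (rule continuous_map_from_subtopology_mono) auto
  from uniformly_continuous_in[OF this V(1,2)] obtain d where "d > 0"
    and close: "\<forall>s\<in>{0..1}. \<forall>t\<in>{0..1}. \<bar>s - t\<bar> < d \<longrightarrow> T s x - T t x \<in> V"
    by metis
  then have d: "T s x - x \<in> V" if "0 \<le> s" "s \<le> 1" "s < d" for s
    using close[rule_format, of s 0] that by (simp add: T_0)
  have "Cesaro_mean \<tau> T h x - x \<in> U" if h: "0 < h" "h < min d 1" for h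
  proof -
    let ?J = "Riemann_integral_in \<tau> 0 h (\<lambda>s. T s x)"
    \<comment> \<open>The gauge of radius 1 is arbitrary; what matters is the sequence of tagged
      sums converging to the integral.\<close>
    obtain p where "\<forall>n. p n tagged_division_of {0..h} \<and> (\<lambda>s. ball s 1) fine p n"
      and lim: "limitin \<tau> (\<lambda>n. tagged_sum (\<lambda>s. T s x) (p n)) ?J sequentially"
      using Riemann_integral_sequence[where g = "\<lambda>_ s. ball s 1", OF orbit_integral_indicator(1)[OF h(1)] gauge_ball[OF zero_less_one]]
      by blast
    then have p: "p n tagged_division_of {0..h}" for n
      by auto
    have "limitin \<tau> (\<lambda>n. (1 / h) *\<^sub>R (?J - tagged_sum (\<lambda>s. T s x) (p n))) 0 sequentially"
      using limitin_scaleR[OF tendsto_const limitin_diff[OF limitin_const_same lim], of "1 / h" ?J] by simp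
    then have "\<forall>\<^sub>F n in sequentially. (1 / h) *\<^sub>R (?J - tagged_sum (\<lambda>s. T s x) (p n)) \<in> V"
      using V(1,2) by (simp add: limitin_def)
    then obtain n where n: "(1 / h) *\<^sub>R (?J - tagged_sum (\<lambda>s. T s x) (p n)) \<in> V"
      by (auto simp: eventually_sequentially)
    have "(1 / (h - 0)) *\<^sub>R tagged_sum (\<lambda>s. T s x - x) (p n) \<in> V"
      using h by (intro tagged_sum_in_convex[OF p] V(3) d) auto
    moreover have "tagged_sum (\<lambda>s. T s x - x) (p n) = tagged_sum (\<lambda>s. T s x) (p n) - h *\<^sub>R x"
      using tagged_sum_const[OF p[of n], where y = x] h
      by (simp add: tagged_sum_def split_beta scaleR_diff_right sum_subtractf)
    ultimately have "(1 / h) *\<^sub>R tagged_sum (\<lambda>s. T s x) (p n) - x \<in> V"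
      using h by (simp add: scaleR_diff_right)
    from V(4)[OF n this] show ?thesis
      by (simp add: Cesaro_mean_def scaleR_diff_right)
  qed
  moreover have "\<forall>\<^sub>F h in at_right 0. 0 < h \<and> h < min d 1"
    using \<open>d > 0\<close> by (intro eventually_conj eventually_at_right_less)
      (auto simp: eventually_at_right[of 0 1] intro!: exI[of _ "min d 1"])
  ultimately show "\<forall>\<^sub>F h in at_right 0. Cesaro_mean \<tau> T h x - x \<in> U"
    by (auto elim: eventually_mono)
qed

lemma T_commute: "t \<ge> 0 \<Longrightarrow> s \<ge> 0 \<Longrightarrow> T t (T s x) = T s (T t x)"
  using T_add[of t s x] T_add[of s t x] by (simp add: add.commute)

lemma orbit_integral_T:
  assumes v: "orbit_integral k x v" and "h \<ge> 0"
  shows "orbit_integral k (T h x) (T h v)"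
  unfolding orbit_integral_def
proof (intro allI impI)
  fix \<psi> assume "seq_functional \<psi>"
  from orbit_integralD[OF v seq_functional_T[OF this \<open>h \<ge> 0\<close>]]
  show "\<psi> (T h v) = (\<integral>t. k t * orbit \<psi> (T h x) t \<partial>lborel)"
    using \<open>h \<ge> 0\<close> by (simp add: T_commute[of h])
qed

text \<open>Shaped for difference quotients: with \<open>c = 1 / h\<close> and \<open>T h z\<close>
  in place of \<open>x\<close>, it transforms the quotient of \<open>z\<close> into that of its
  integral.\<close>

lemma orbit_integral_diff_scale_arg:
  assumes k: "integrable lborel k" and "orbit_integral k x v" "orbit_integral k y w"
  shows "orbit_integral k (c *\<^sub>R (x - y)) (c *\<^sub>R (v - w))"
  unfolding orbit_integral_def
proof (intro allI impI)
  fix \<psi> assume \<psi>: "seq_functional \<psi>"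
  interpret bounded_linear \<psi>
    using \<psi> by (rule seq_functional_bounded_linear)
  have "(\<integral>t. k t * orbit \<psi> (c *\<^sub>R (x - y)) t \<partial>lborel) =
      (\<integral>t. c * (k t * orbit \<psi> x t - k t * orbit \<psi> y t) \<partial>lborel)"
    by (simp add: blinfun.bilinear_simps diff scale algebra_simps)
  also have "\<dots> = c * (\<psi> v - \<psi> w)"
    using integrable_kernel_orbit[OF k \<psi>] assms(2,3)[THEN orbit_integralD[OF _ \<psi>]] by simp
  finally show "\<psi> (c *\<^sub>R (v - w)) = (\<integral>t. k t * orbit \<psi> (c *\<^sub>R (x - y)) t \<partial>lborel)"
    by (simp add: diff scale)
qed

text \<open>After testing with \<open>\<psi>\<close> the integrands are scalar: they converge
  pointwise because each composition of \<open>\<psi>\<close> with \<open>T\<close> is again a test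
  functional, and contractivity supplies the majorant.\<close>

lemma orbit_integral_tendsto:
  assumes k: "integrable lborel k" and V: "\<And>n. orbit_integral k (X n) (V n)"
    and v: "orbit_integral k y v" and B: "\<And>n. norm (X n) \<le> B" and X: "limitin \<tau> X y sequentially"
    and \<psi>: "seq_functional \<psi>"
  shows "(\<lambda>n. \<psi> (V n)) \<longlonglongrightarrow> \<psi> v"
  unfolding orbit_integralD[OF V \<psi>] orbit_integralD[OF v \<psi>]
proof (rule integral_dominated_convergence)
  show "(\<lambda>t. k t * orbit \<psi> y t) \<in> borel_measurable lborel"
    "(\<lambda>t. k t * orbit \<psi> (X n) t) \<in> borel_measurable lborel" for n
    using integrable_kernel_orbit[OF k \<psi>] by blast+
  show "integrable lborel (\<lambda>t. \<bar>k t\<bar> * (onorm \<psi> * B))"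
    using k by simp
  have "(\<lambda>n. orbit \<psi> (X n) t) \<longlonglongrightarrow> orbit \<psi> y t" for t
    using B X by (intro seq_functional_tendsto[OF seq_functional_T[OF \<psi>]]) auto
  then show "AE t in lborel. (\<lambda>n. k t * orbit \<psi> (X n) t) \<longlonglongrightarrow> k t * orbit \<psi> y t"
    by (intro AE_I2 tendsto_mult_left)
  have "\<bar>k t * orbit \<psi> (X n) t\<bar> \<le> \<bar>k t\<bar> * (onorm \<psi> * B)" for n t
    unfolding abs_mult
    using B onorm_pos_le[OF seq_functional_bounded_linear[OF \<psi>]]
    by (intro mult_left_mono order_trans[OF abs_orbit_le[OF \<psi>] mult_left_mono]) auto
  then show "AE t in lborel. norm (k t * orbit \<psi> (X n) t) \<le> \<bar>k t\<bar> * (onorm \<psi> * B)" for n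
    by simp
qed

text \<open>Substituting \<open>h + t\<close> for \<open>t\<close> and using the semigroup law pulls
  out \<open>exp (- (\<mu> * h))\<close> and \<open>T h\<close>.\<close>

lemma orbit_integral_exp_kernel_shift:
  assumes v: "orbit_integral (exp_kernel \<mu>) x v" and "\<mu> > 0" "h \<ge> 0"
  shows "orbit_integral (\<lambda>t. exp_kernel \<mu> t * indicator {h..} t) x (exp (- (\<mu> * h)) *\<^sub>R T h v)"
  unfolding orbit_integral_def
proof (intro allI impI)
  fix \<psi> assume \<psi>: "seq_functional \<psi>"
  interpret bounded_linear \<psi>
    using \<psi> by (rule seq_functional_bounded_linear)
  have "exp_kernel \<mu> (h + t) * indicator {h..} (h + t) * orbit \<psi> x (h + t) =
      exp (- (\<mu> * h)) * (exp_kernel \<mu> t * \<psi> (T h (T (max 0 t) x)))" for t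
    using \<open>h \<ge> 0\<close> by (cases "t \<ge> 0") (simp_all add: exp_kernel_def T_add distrib_left exp_add[symmetric])
  then have "(\<integral>t. exp_kernel \<mu> t * indicator {h..} t * orbit \<psi> x t \<partial>lborel)
      = exp (- (\<mu> * h)) * \<psi> (T h v)"
    using lborel_integral_real_affine[of 1 "\<lambda>t. exp_kernel \<mu> t * indicator {h..} t * orbit \<psi> x t" h]
      orbit_integralD[OF v seq_functional_T[OF \<psi> \<open>h \<ge> 0\<close>]]
    by simp
  then show "\<psi> (exp (- (\<mu> * h)) *\<^sub>R T h v) =
      (\<integral>t. exp_kernel \<mu> t * indicator {h..} t * orbit \<psi> x t \<partial>lborel)"
    by (simp add: scale)
qed

text \<open>The first two terms leave the Laplace integral over [0, h], and the last is the same
  integral without its exponential weight. On this interval the weight deviates from 1 by at most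
  \<open>\<mu> * h\<close>, and the length contributes another \<open>h\<close>.\<close>

lemma norm_exp_kernel_shift_le:
  assumes v: "orbit_integral (exp_kernel \<mu>) x v" and "\<mu> > 0" "h > 0"
  shows "norm (v - exp (- (\<mu> * h)) *\<^sub>R T h v - h *\<^sub>R Cesaro_mean \<tau> T h x) \<le> \<mu> * h\<^sup>2 * norm x"
proof -
  let ?k = "\<lambda>t. exp_kernel \<mu> t - exp_kernel \<mu> t * indicator {h..} t"
  have ik: "integrable lborel (exp_kernel \<mu>)" "integrable lborel (\<lambda>t. exp_kernel \<mu> t * indicator {h..} t)"
    using integrable_exp_kernel[OF \<open>\<mu> > 0\<close>]
      integrable_real_mult_indicator[OF _ integrable_exp_kernel[OF \<open>\<mu> > 0\<close>], of "{h..}"]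
    by simp_all
  have "norm (v - exp (- (\<mu> * h)) *\<^sub>R T h v - h *\<^sub>R Cesaro_mean \<tau> T h x)
      \<le> (\<integral>t. \<bar>?k t - indicator {0..h} t\<bar> \<partial>lborel) * norm x"
    using v \<open>h > 0\<close> \<open>\<mu> > 0\<close> ik orbit_integral_indicator(2)[OF \<open>h > 0\<close>]
    by (intro norm_orbit_integral_diff_le orbit_integral_diff orbit_integral_exp_kernel_shift)
      (auto simp: Cesaro_mean_def)
  also have "(\<integral>t. \<bar>?k t - indicator {0..h} t\<bar> \<partial>lborel) \<le> (\<integral>t. indicator {0..h} t * (\<mu> * h) \<partial>lborel)"
  proof (rule integral_mono_AE)
    \<comment> \<open>At \<open>t = h\<close> both indicators are 1 and the left side is 1, which
      may exceed \<open>\<mu> * h\<close>; one point is negligible.\<close>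
    have "\<bar>?k t - indicator {0..h} t\<bar> \<le> indicator {0..h} t * (\<mu> * h)" if "t \<noteq> h" for t
    proof (cases "0 \<le> t \<and> t < h")
      case True
      then have "\<mu> * t \<le> \<mu> * h"
        using \<open>\<mu> > 0\<close> by simp
      then have "1 - exp (- (\<mu> * t)) \<le> \<mu> * h"
        using exp_ge_add_one_self[of "- (\<mu> * t)"] by linarith
      moreover have "exp (- (\<mu> * t)) \<le> 1"
        using True \<open>\<mu> > 0\<close> by simp
      ultimately show ?thesis
        using True by (simp add: exp_kernel_def)
    next
      case False
      then show ?thesis
        using that by (auto simp: exp_kernel_def indicator_def)
    qed
    then show "AE t in lborel. \<bar>?k t - indicator {0..h} t\<bar> \<le> indicator {0..h} t * (\<mu> * h)"
      using AE_lborel_singleton[of h] by (auto elim: eventually_mono)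
  qed (use ik \<open>h > 0\<close> in \<open>auto intro!: integrable_abs Bochner_Integration.integrable_diff\<close>)
  also have "(\<integral>t. indicator {0..h} t * (\<mu> * h) \<partial>lborel) = \<mu> * h\<^sup>2"
    using \<open>h > 0\<close> by (simp add: power2_eq_square)
  finally show ?thesis
    by (simp add: mult_right_mono)
qed

text \<open>Together the two claims say that the Laplace integral \<open>v\<close> lies in the
  domain of A and that A v = \<mu> v - x, so \<mu> - A is onto.\<close>

lemma exp_kernel_difference_quotient:
  assumes v: "orbit_integral (exp_kernel \<mu>) x v" and "\<mu> > 0"
  shows "limitin \<tau> (\<lambda>h. (T h v - v) /\<^sub>R h) (\<mu> *\<^sub>R v - x) (at_right 0)"
    and "bdd_above ((\<lambda>h. norm ((T h v - v) /\<^sub>R h)) ` {0<..<1})"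
proof -
  \<comment> \<open>The remainder that tends to 0 in norm; the quotient thereby reduces to a scalar
    derivative and the Cesaro mean over short times, which converges only in
    \<open>\<tau>\<close>.\<close>
  define w where "w = (\<lambda>h. (v - exp (- (\<mu> * h)) *\<^sub>R T h v - h *\<^sub>R Cesaro_mean \<tau> T h x) /\<^sub>R h)"
  have norm_w: "norm (w h) \<le> \<mu> * h * norm x" if "h > 0" for h
  proof -
    have "norm (w h) = norm (v - exp (- (\<mu> * h)) *\<^sub>R T h v - h *\<^sub>R Cesaro_mean \<tau> T h x) / h"
      using that by (simp add: w_def divide_inverse mult.commute)
    also have "\<dots> \<le> \<mu> * h\<^sup>2 * norm x / h"
      using that by (intro divide_right_mono norm_exp_kernel_shift_le[OF assms]) auto
    finally show ?thesis
      using that by (simp add: power2_eq_square)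
  qed
  have quot: "(T h v - v) /\<^sub>R h = ((exp (\<mu> * h) - 1) / h) *\<^sub>R v - exp (\<mu> * h) *\<^sub>R (w h + Cesaro_mean \<tau> T h x)"
    if "h > 0" for h
  proof -
    have "exp (\<mu> * h) *\<^sub>R (w h + Cesaro_mean \<tau> T h x) = (exp (\<mu> * h) / h) *\<^sub>R (v - exp (- (\<mu> * h)) *\<^sub>R T h v)"
      using that by (simp add: w_def scaleR_diff_right divide_inverse)
    also have "\<dots> = (exp (\<mu> * h) / h) *\<^sub>R v - (1 / h) *\<^sub>R T h v"
      by (simp add: scaleR_diff_right flip: exp_add)
    finally show ?thesis
      by (simp add: algebra_simps diff_divide_distrib divide_inverse)
  qed
  have "((\<lambda>h. \<mu> * h * norm x) \<longlongrightarrow> 0) (at_right 0)"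
    by (auto intro!: tendsto_eq_intros)
  then have "(w \<longlongrightarrow> 0) (at_right 0)"
    by (rule Lim_null_comparison[rotated]) (use norm_w in \<open>auto simp: eventually_at_filter\<close>)
  moreover have "((\<lambda>h. (exp (\<mu> * h) - 1) / h) \<longlongrightarrow> \<mu>) (at_right 0)" "((\<lambda>h. exp (\<mu> * h)) \<longlongrightarrow> 1) (at_right 0)"
    by real_asymp+
  ultimately have "limitin \<tau> (\<lambda>h. ((exp (\<mu> * h) - 1) / h) *\<^sub>R v - exp (\<mu> * h) *\<^sub>R (w h + Cesaro_mean \<tau> T h x))
      (\<mu> *\<^sub>R v - 1 *\<^sub>R (0 + x)) (at_right 0)"
    by (intro limitin_diff limitin_scaleR limitin_add limitin_const_same limitin_Cesaro_mean_0 tendsto_imp_limitin)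
  moreover have "\<forall>\<^sub>F h in at_right 0. ((exp (\<mu> * h) - 1) / h) *\<^sub>R v - exp (\<mu> * h) *\<^sub>R (w h + Cesaro_mean \<tau> T h x)
      = (T h v - v) /\<^sub>R h"
    using quot by (auto simp: eventually_at_filter)
  ultimately show "limitin \<tau> (\<lambda>h. (T h v - v) /\<^sub>R h) (\<mu> *\<^sub>R v - x) (at_right 0)"
    using limitin_transform_eventually by simp
  have "norm ((T h v - v) /\<^sub>R h) \<le> \<mu> * exp \<mu> * norm v + exp \<mu> * (\<mu> * norm x + norm x)" if "h \<in> {0<..<1}" for h
  proof -
    have h: "0 < h" "\<mu> * h \<le> \<mu>"
      using that \<open>\<mu> > 0\<close> by auto
    \<comment> \<open>Yields \<open>exp u - 1 \<le> u * exp u\<close> at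
      \<open>u = \<mu> * h\<close>, a bound on the scalar quotient uniform over the unit
      interval.\<close>
    have "exp (\<mu> * h) * (1 - \<mu> * h) \<le> exp (\<mu> * h) * exp (- (\<mu> * h))"
      using exp_ge_add_one_self[of "- (\<mu> * h)"] by (intro mult_left_mono) auto
    then have "exp (\<mu> * h) - 1 \<le> h * (\<mu> * exp (\<mu> * h))"
      by (simp add: algebra_simps flip: exp_add)
    also have "\<dots> \<le> h * (\<mu> * exp \<mu>)"
      using h \<open>\<mu> > 0\<close> by (intro mult_left_mono) auto
    finally have "(exp (\<mu> * h) - 1) / h \<le> \<mu> * exp \<mu>"
      using h(1) by (simp add: pos_divide_le_eq mult.commute)
    moreover have "0 \<le> (exp (\<mu> * h) - 1) / h"
      using h(1) \<open>\<mu> > 0\<close> by simp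
    ultimately have "norm (((exp (\<mu> * h) - 1) / h) *\<^sub>R v) \<le> \<mu> * exp \<mu> * norm v"
      unfolding norm_scaleR by (intro mult_right_mono) auto
    moreover have "norm (w h + Cesaro_mean \<tau> T h x) \<le> \<mu> * norm x + norm x"
    proof (rule norm_triangle_mono)
      show "norm (w h) \<le> \<mu> * norm x"
        using norm_w[OF h(1)] mult_right_mono[OF h(2) norm_ge_zero] by (rule order_trans)
      have "norm (Riemann_integral_in \<tau> 0 h (\<lambda>s. T s x)) \<le> h * norm x"
        using norm_orbit_integral_le[OF _ orbit_integral_indicator(2)[OF h(1)]] h(1) by simp
      then show "norm (Cesaro_mean \<tau> T h x) \<le> norm x"
        using h(1) by (simp add: Cesaro_mean_def field_simps)
    qed
    then have "norm (exp (\<mu> * h) *\<^sub>R (w h + Cesaro_mean \<tau> T h x)) \<le> exp \<mu> * (\<mu> * norm x + norm x)"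
      unfolding norm_scaleR using h by (intro mult_mono) auto
    ultimately show ?thesis
      unfolding quot[OF h(1)] using norm_triangle_ineq4 add_mono order_trans by meson
  qed
  then show "bdd_above ((\<lambda>h. norm ((T h v - v) /\<^sub>R h)) ` {0<..<1})"
    by (rule bdd_aboveI2)
qed

text \<open>Let \<open>v\<close> be the Laplace integral of \<open>z\<close>. Transforming the
  quotients of \<open>z\<close> shows that those of \<open>v\<close> converge weakly to \<mu> v,
  whereas they converge to \<mu> v - z by the formula for A v; hence \<open>z\<close> vanishes. The
  bound \<open>B\<close> makes the first limit admissible for test functionals.\<close>

lemma eigenvector_eq_0:
  assumes "\<mu> > 0" and lim: "limitin \<tau> (\<lambda>h. (T h z - z) /\<^sub>R h) (\<mu> *\<^sub>R z) (at_right 0)"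
    and B: "\<And>h. h \<in> {0<..<1} \<Longrightarrow> norm ((T h z - z) /\<^sub>R h) \<le> B"
  shows "z = 0"
proof (rule eq_if_dual_eq)
  fix \<phi> assume \<phi>: "\<phi> \<in> topological_dual \<tau>"
  then have \<phi>s: "seq_functional \<phi>"
    by (rule dual_seq_functional)
  interpret bounded_linear \<phi>
    using \<phi>s by (rule seq_functional_bounded_linear)
  note ik = integrable_exp_kernel[OF \<open>\<mu> > 0\<close>]
  obtain v where v: "orbit_integral (exp_kernel \<mu>) z v"
    using ex_orbit_integral_exp_kernel[OF \<open>\<mu> > 0\<close>] by blast
  \<comment> \<open>Test functionals handle sequences only. The double successor keeps
    \<open>h 0\<close> below 1, inside the range where \<open>B\<close> applies.\<close>
  define h where "h = (\<lambda>n. inverse (real (Suc (Suc n))))"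
  have h: "h n \<in> {0<..<1}" for n
    by (simp add: h_def inverse_less_1_iff)
  have h0: "filterlim h (at_right 0) sequentially"
    unfolding h_def by real_asymp
  have "(\<lambda>n. \<phi> ((T (h n) v - v) /\<^sub>R h n)) \<longlonglongrightarrow> \<phi> (\<mu> *\<^sub>R v)"
  proof (rule orbit_integral_tendsto[OF ik _ _ _ _ \<phi>s])
    show "orbit_integral (exp_kernel \<mu>) ((T (h n) z - z) /\<^sub>R h n) ((T (h n) v - v) /\<^sub>R h n)" for n
      using h[of n] v by (intro orbit_integral_diff_scale_arg orbit_integral_T ik) auto
    show "orbit_integral (exp_kernel \<mu>) (\<mu> *\<^sub>R z) (\<mu> *\<^sub>R v)"
    proof -
      have "orbit_integral (exp_kernel \<mu>) 0 0"
        by (simp add: orbit_integral_def linear_0 bounded_linear.linear seq_functional_bounded_linear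
          blinfun.zero_right)
      from orbit_integral_diff_scale_arg[OF ik v this, of \<mu>] show ?thesis
        by simp
    qed
    show "norm ((T (h n) z - z) /\<^sub>R h n) \<le> B" for n
      using h by (rule B)
    show "limitin \<tau> (\<lambda>n. (T (h n) z - z) /\<^sub>R h n) (\<mu> *\<^sub>R z) sequentially"
      using lim h0 by (rule limitin_compose_filterlim)
  qed
  moreover have "(\<lambda>n. \<phi> ((T (h n) v - v) /\<^sub>R h n)) \<longlonglongrightarrow> \<phi> (\<mu> *\<^sub>R v - z)"
    using \<phi> limitin_compose_filterlim[OF exp_kernel_difference_quotient(1)[OF v \<open>\<mu> > 0\<close>] h0]
    by (rule dual_limitin)
  ultimately have "\<phi> (\<mu> *\<^sub>R v) = \<phi> (\<mu> *\<^sub>R v - z)"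
    by (rule LIMSEQ_unique)
  then show "\<phi> z = \<phi> 0"
    by (simp add: diff zero)
qed

lemma limitin_generator:
  assumes "x \<in> generator_domain \<tau> T"
  shows "limitin \<tau> (\<lambda>h. (T h x - x) /\<^sub>R h) (generator \<tau> T x) (at_right 0)"
proof -
  obtain y where y: "limitin \<tau> (\<lambda>h. (T h x - x) /\<^sub>R h) y (at_right 0)"
    using assms by (auto simp: generator_domain_def)
  with Lim_in_eq[OF y] show ?thesis
    by (simp add: generator_def)
qed

text \<open>The difference of two preimages is an eigenvector for \<open>\<mu>\<close>, and the
  boundedness condition in the domain of A supplies the bound under which such a vector
  vanishes.\<close>

lemma inj_on_generator_shift:
  assumes "\<mu> > 0"
  shows "inj_on (\<lambda>y. \<mu> *\<^sub>R y - generator \<tau> T y) (generator_domain \<tau> T)"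
proof (rule inj_onI)
  fix y z assume y: "y \<in> generator_domain \<tau> T" and z: "z \<in> generator_domain \<tau> T"
    and eq: "\<mu> *\<^sub>R y - generator \<tau> T y = \<mu> *\<^sub>R z - generator \<tau> T z"
  have quot: "(T h (y - z) - (y - z)) /\<^sub>R h = (T h y - y) /\<^sub>R h - (T h z - z) /\<^sub>R h" for h
    by (simp add: blinfun.bilinear_simps algebra_simps)
  obtain B where B: "\<forall>h\<in>{0<..<1}. norm ((T h y - y) /\<^sub>R h) \<le> B"
    using y unfolding generator_domain_def bdd_above_def by blast
  obtain C where C: "\<forall>h\<in>{0<..<1}. norm ((T h z - z) /\<^sub>R h) \<le> C"
    using z unfolding generator_domain_def bdd_above_def by blast
  have "y - z = 0"
  proof (rule eigenvector_eq_0[OF \<open>\<mu> > 0\<close>])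
    have "generator \<tau> T y - generator \<tau> T z = \<mu> *\<^sub>R (y - z)"
      using eq by (simp add: algebra_simps)
    then show "limitin \<tau> (\<lambda>h. (T h (y - z) - (y - z)) /\<^sub>R h) (\<mu> *\<^sub>R (y - z)) (at_right 0)"
      using limitin_diff[OF limitin_generator[OF y] limitin_generator[OF z]] by (simp add: quot)
    show "norm ((T h (y - z) - (y - z)) /\<^sub>R h) \<le> B + C" if "h \<in> {0<..<1}" for h
      unfolding quot using bspec[OF B that] bspec[OF C that] by (rule order_trans[OF norm_triangle_ineq4 add_mono])
  qed
  then show "y = z"
    by simp
qed

text \<open>The Laplace integral is a preimage of \<open>x\<close> under \<mu> - A, and by
  injectivity the only one.\<close>

lemma orbit_integral_resolvent:
  assumes "\<mu> > 0"
  shows "orbit_integral (exp_kernel \<mu>) x (resolvent (generator_domain \<tau> T) (generator \<tau> T) \<mu> x)"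
proof -
  obtain v where v: "orbit_integral (exp_kernel \<mu>) x v"
    using ex_orbit_integral_exp_kernel[OF assms] by blast
  note quot = exp_kernel_difference_quotient[OF v assms]
  have "v \<in> generator_domain \<tau> T"
    using quot by (auto simp: generator_domain_def)
  moreover have "\<mu> *\<^sub>R v - generator \<tau> T v = x"
    using Lim_in_eq[OF quot(1)] by (simp add: generator_def)
  ultimately have "resolvent (generator_domain \<tau> T) (generator \<tau> T) \<mu> x = v"
    unfolding resolvent_def using inj_on_generator_shift[OF assms] by (intro the_inv_into_f_eq)
  with v show ?thesis
    by simp
qed

lemma rescaled_limit_resolvent_iff:
  "rescaled_limit x y (exp_kernel 1) \<longleftrightarrow>
    limitin \<tau> (\<lambda>\<mu>. \<mu> *\<^sub>R resolvent (generator_domain \<tau> T) (generator \<tau> T) \<mu> x) y (at_right 0)"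
proof -
  have "rescale \<mu> (exp_kernel 1) = (\<lambda>t. \<mu> * exp_kernel \<mu> t)" if "\<mu> > 0" for \<mu>
    using that by (auto simp: rescale_def exp_kernel_def indicator_def zero_le_mult_iff)
  then have "orbit_integral (rescale \<mu> (exp_kernel 1)) x
      (\<mu> *\<^sub>R resolvent (generator_domain \<tau> T) (generator \<tau> T) \<mu> x)" if "\<mu> > 0" for \<mu>
    using orbit_integral_scale[OF orbit_integral_resolvent[OF that]] that by simp
  then show ?thesis
    using integrable_exp_kernel[of 1] integral_exp_kernel[of 1] by (subst rescaled_limit_iff) auto
qed

lemma limitin_Cesaro_mean_iff:
  "limitin \<tau> (\<lambda>r. Cesaro_mean \<tau> T r x) y at_top \<longleftrightarrow>
    limitin \<tau> (\<lambda>\<mu>. \<mu> *\<^sub>R resolvent (generator_domain \<tau> T) (generator \<tau> T) \<mu> x) y (at_right 0)"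
  using rescaled_limit_indicator_iff rescaled_limit_exp_kernel_iff rescaled_limit_resolvent_iff by simp

end

theorem proposition3p8:
  fixes \<tau> :: "'a::banach topology"
    and T :: "real \<Rightarrow> 'a \<Rightarrow>\<^sub>L 'a"
    and D :: "'a set"
    and A :: "'a \<Rightarrow> 'a"
  assumes "bicontinuous_setting \<tau>"
    and "bicontinuous_semigroup \<tau> T"
    and "contraction_semigroup T"
    and "D = generator_domain \<tau> T"
    and "A = generator \<tau> T"
  shows "(mean_ergodic \<tau> T \<longleftrightarrow>
            (\<forall>x. \<exists>y. limitin \<tau> (\<lambda>\<mu>. \<mu> *\<^sub>R resolvent D A \<mu> x) y (at_right 0))) \<and>
         (\<forall>x. (\<exists>y. limitin \<tau> (\<lambda>r. Cesaro_mean \<tau> T r x) y at_top) \<or>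
              (\<exists>y. limitin \<tau> (\<lambda>\<mu>. \<mu> *\<^sub>R resolvent D A \<mu> x) y (at_right 0)) \<longrightarrow>
            (\<exists>y. limitin \<tau> (\<lambda>r. Cesaro_mean \<tau> T r x) y at_top) \<and>
            (\<exists>y. limitin \<tau> (\<lambda>\<mu>. \<mu> *\<^sub>R resolvent D A \<mu> x) y (at_right 0)) \<and>
            Lim_in \<tau> at_top (\<lambda>r. Cesaro_mean \<tau> T r x) =
              Lim_in \<tau> (at_right 0) (\<lambda>\<mu>. \<mu> *\<^sub>R resolvent D A \<mu> x)) \<and>
         (mean_ergodic \<tau> T \<longrightarrow>
            (\<forall>x. limitin \<tau> (\<lambda>\<mu>. \<mu> *\<^sub>R resolvent D A \<mu> x)
                   (mean_ergodic_projection \<tau> T x) (at_right 0)))"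
proof -
  interpret bicontinuous_contraction \<tau> T
    using assms by unfold_locales
  have iff: "limitin \<tau> (\<lambda>\<mu>. \<mu> *\<^sub>R resolvent D A \<mu> x) y (at_right 0) \<longleftrightarrow>
      limitin \<tau> (\<lambda>r. Cesaro_mean \<tau> T r x) y at_top" for x y
    using limitin_Cesaro_mean_iff assms(4,5) by simp
  have "limitin \<tau> (\<lambda>r. Cesaro_mean \<tau> T r x) (mean_ergodic_projection \<tau> T x) at_top"
    if "mean_ergodic \<tau> T" for x
  proof -
    obtain y where y: "limitin \<tau> (\<lambda>r. Cesaro_mean \<tau> T r x) y at_top"
      using \<open>mean_ergodic \<tau> T\<close> unfolding mean_ergodic_def by blast
    with Lim_in_eq[OF y] show ?thesis
      by (simp add: mean_ergodic_projection_def)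
  qed
  then show ?thesis
    \<comment> \<open>Rewriting with \<open>iff\<close> inside the definite descriptions makes the
      two limits syntactically equal.\<close>
    unfolding mean_ergodic_def Lim_in_def iff by simp
qed

end
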